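(* Let $\mathbb{D}$ be a non-dictatorial, tops-only, unidimensional domain. Then the following two statements hold. (i) There exists an anonymous and strategy-proof rule on $\mathbb{D}$ (for some number $n\ge2$ of voters) if and only if $\mathbb{D}$ is a single-peaked domain on $\mathcal{L}^A$. (ii) There exists no anonymous and strategy-proof rule on $\mathbb{D}$ (for any number $n\geq 2$ of voters) if and only if $\mathbb{D}$ is a non-degenerate hybrid domain on $\mathcal{L}^A$.
   Context: **Model.** $A$ is a finite set of alternatives, $|A|=m\ge 3$. A preference is a linear order $P_i$ on $A$; $r_k(P_i)$ is its $k$-th ranked alternative, $r_1(P_i)$ its peak, $\max^{P_i}(B)$ the $P_i$-best element of $B\subseteq A$. A domain $\mathbb{D}$ is a set of preferences; $\mathbb{D}^a=\{P_i\in\mathbb{D}:r_1(P_i)=a\}$. Voters: $N=\{1,\dots,n\}$, $n\ge2$. An SCF is a map $f:\mathbb{D}^n\to A$; it is a rule if unanimous ($f(P)=a$ whenever all peaks at $P$ equal $a$); strategy-proof if for all $i$, $P_i,P_i'\in\mathbb{D}$, $P_{-i}\in\mathbb{D}^{n-1}$, either $f(P_i,P_{-i})=f(P_i',P_{-i})$ or $f(P_i,P_{-i})\mathrel{P_i}f(P_i',P_{-i})$; tops-only if $f(P)=f(P')$ whenever $r_1(P_i)=r_1(P_i')$ for all $i$; anonymous if $f(P_1,\dots,P_n)=f(P_{\sigma(1)},\dots,P_{\sigma(n)})$ for all profiles and permutations $\sigma$ of $N$; a dictatorship if for some $i$, $f(P)=r_1(P_i)$ for all $P$. $\mathbb{D}$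 is non-dictatorial if for some $n\ge2$ it admits a strategy-proof rule that is not a dictatorship. $\mathbb{D}$ is a tops-only domain if for every $n\ge2$ every strategy-proof rule $f:\mathbb{D}^n\to A$ is tops-only. **Unidimensional domains.** $a\ne b$ are adjacent ($a\sim b$) if there are $P_i,P_i'\in\mathbb{D}$ with $r_1(P_i)=r_2(P_i')=a$, $r_1(P_i')=r_2(P_i)=b$, $r_k(P_i)=r_k(P_i')$ for $k\ge3$. The adjacency graph $G_\sim^A$ has vertex set $A$ and edges the adjacent pairs; $\mathcal{N}_\sim^A(x)$ is the set of neighbors of $x$ in it, and $\mathrm{Leaf}(G_\sim^A)$ the set of vertices with exactly one neighbor. Path-connectedness: $G_\sim^A$ is connected. Diversity: $\mathbb{D}$ contains two completely reversed preferences ($a\mathrel{P_i}b\Leftrightarrow b\mathrel{P_i'}a$ for all $a\neq b$). With $\mathcal{S}(\mathbb{D}^a)=\{r_2(P_i):P_i\in\mathbb{D}^a\}$, leaf symmetry: for each $x\in\mathrm{Leaf}(G_\sim^A)$ with $|\mathcal{S}(\mathbb{D}^x)|>1$ there is $z\in\mathcal{S}(\mathbb{D}^x)$ with $z\notin\mathcal{N}_\sim^A(x)$ and $x\in\mathcal{S}(\mathbb{D}^z)$. A domain is unidimensional if it satisfies path-connectedness, diversity and leaf symmetry. **Labelling and the line $\mathcal{L}^A$.** For a domain satisfying diversity, fix a pair of completely reversed preferences $\underline{P},\overline{P}\in\mathbb{D}$ and label the alternatives $A=\{a_1,\dots,a_m\}$ so that $a_k\mathrel{\underline{P}}a_{k+1}$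 and $a_{k+1}\mathrel{\overline{P}}a_k$ for $k=1,\dots,m-1$. $\mathcal{L}^A=(a_1,\dots,a_m)$ is the line (path graph) with edges $(a_k,a_{k+1})$. **Trees.** $\mathcal{T}^A$ denotes a tree with vertex set $A$; $\langle x,y|\mathcal{T}^A\rangle$ is the unique path between $x$ and $y$ (also its vertex set). For $x\ne y$, $A^{x\rightharpoonup y}=\{z\in A: x\in\langle z,y|\mathcal{T}^A\rangle\}$. Distinct $a,b$ are dual-thresholds in $\mathcal{T}^A$ if for every $c\in A\setminus\langle a,b|\mathcal{T}^A\rangle$ the projection of $c$ on $\langle a,b|\mathcal{T}^A\rangle$ (the unique vertex of that path lying on every path from $c$ to a vertex of it) is $a$ or $b$. (In a line any two distinct vertices are dual-thresholds.) **Single-peaked domains.** $\mathbb{D}_{\mathrm{SP}}(\mathcal{T}^A)$ is the set of preferences $P_i$ such that for all distinct $a,b$, $a\in\langle r_1(P_i),b|\mathcal{T}^A\rangle$ implies $a\mathrel{P_i}b$. $\mathbb{D}$ is a single-peaked domain on $\mathcal{T}^A$ if $\mathbb{D}\subseteq\mathbb{D}_{\mathrm{SP}}(\mathcal{T}^A)$ and $G_\sim^A$ is connected. **Hybrid domains.** For dual-thresholds $a,b$, $\mathbb{D}_{\mathrm{H}}(\mathcal{T}^A,a,b)$ is the set of preferences $P_i$ such that (1) for all distinct $y,z\in A^{a\rightharpoonup b}$ or $y,z\in A^{b\rightharpoonup a}$, $y\in\langle r_1(P_i),z|\mathcal{T}^A\rangle$ implies $y\mathrel{P_i}z$; (2)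 $r_1(P_i)\in A^{a\rightharpoonup b}\setminus\{a\}$ implies $\max^{P_i}(\langle a,b|\mathcal{T}^A\rangle)=a$, and $r_1(P_i)\in A^{b\rightharpoonup a}\setminus\{b\}$ implies $\max^{P_i}(\langle a,b|\mathcal{T}^A\rangle)=b$. $\mathbb{D}$ is an $(a,b)$-hybrid domain on $\mathcal{T}^A$ if: (i) $\mathbb{D}\subseteq\mathbb{D}_{\mathrm{H}}(\mathcal{T}^A,a,b)$ and $G_\sim^A$ is connected; (ii) there are no tree $\widehat{\mathcal{T}}^A$ and dual-thresholds $\hat a,\hat b$ in it with $\mathbb{D}\subseteq\mathbb{D}_{\mathrm{H}}(\widehat{\mathcal{T}}^A,\hat a,\hat b)$ and $\langle\hat a,\hat b|\widehat{\mathcal{T}}^A\rangle\subsetneq\langle a,b|\mathcal{T}^A\rangle$ as vertex sets; (iii) $|\langle a,b|\mathcal{T}^A\rangle|\ge3$. It is non-degenerate if $A^{a\rightharpoonup b}\ne\{a\}$ or $A^{b\rightharpoonup a}\neq\{b\}$. "A non-degenerate hybrid domain on $\mathcal{L}^A$" means: a non-degenerate $(a,b)$-hybrid domain on $\mathcal{L}^A$ for some dual-thresholds $a,b$ in $\mathcal{L}^A$. *)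

theory Defs
  imports
    "HOL-Library.FuncSet"
    "HOL-Library.Cardinality"
    "HOL-Combinatorics.Permutations"
begin

text \<open>The set of alternatives is the universe of a finite type. A preference is a (reflexive)
  linear order on it, where \<open>(x, y) \<in> P\<close> means that \<open>x\<close> is at least as good as \<open>y\<close>; for
  distinct \<open>x\<close> and \<open>y\<close> this is strict preference.\<close>

type_synonym 'a pref = "'a rel"

definition ranked :: "nat \<Rightarrow> 'a::finite pref \<Rightarrow> 'a" where
  "ranked k P = (THE x. card {y. (y, x) \<in> P} = k)"

abbreviation peak :: "'a::finite pref \<Rightarrow> 'a" where
  "peak P \<equiv> ranked 1 P"

definition best :: "'a pref \<Rightarrow> 'a set \<Rightarrow> 'a" where
  "best P B = (THE x. x \<in> B \<and> (\<forall>y\<in>B. (x, y) \<in> P))"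

definition pref_domain :: "'a pref set \<Rightarrow> bool" where
  "pref_domain D \<longleftrightarrow> (\<forall>P\<in>D. linear_order P)"

definition with_peak :: "'a::finite pref set \<Rightarrow> 'a \<Rightarrow> 'a pref set" where
  "with_peak D a = {P \<in> D. peak P = a}"


subsection \<open>Social choice functions\<close>

text \<open>A social choice function is only inspected on \<open>profiles D n\<close>; its values elsewhere
  are irrelevant to all notions below.\<close>

type_synonym 'a scf = "(nat \<Rightarrow> 'a pref) \<Rightarrow> 'a"

definition profiles :: "'a pref set \<Rightarrow> nat \<Rightarrow> (nat \<Rightarrow> 'a pref) set" where
  "profiles D n = {1..n} \<rightarrow>\<^sub>E D"

definition is_rule :: "'a::finite pref set \<Rightarrow> nat \<Rightarrow> 'a scf \<Rightarrow> bool" where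
  "is_rule D n f \<longleftrightarrow>
     (\<forall>P\<in>profiles D n. \<forall>a. (\<forall>i\<in>{1..n}. peak (P i) = a) \<longrightarrow> f P = a)"

definition strategy_proof :: "'a pref set \<Rightarrow> nat \<Rightarrow> 'a scf \<Rightarrow> bool" where
  "strategy_proof D n f \<longleftrightarrow>
     (\<forall>P\<in>profiles D n. \<forall>i\<in>{1..n}. \<forall>Q\<in>D.
        f P = f (P(i := Q)) \<or> (f P, f (P(i := Q))) \<in> P i)"

definition tops_only :: "'a::finite pref set \<Rightarrow> nat \<Rightarrow> 'a scf \<Rightarrow> bool" where
  "tops_only D n f \<longleftrightarrow>
     (\<forall>P\<in>profiles D n. \<forall>Q\<in>profiles D n.
        (\<forall>i\<in>{1..n}. peak (P i) = peak (Q i)) \<longrightarrow> f P = f Q)"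

definition anonymous :: "'a pref set \<Rightarrow> nat \<Rightarrow> 'a scf \<Rightarrow> bool" where
  "anonymous D n f \<longleftrightarrow>
     (\<forall>P\<in>profiles D n. \<forall>\<sigma>. \<sigma> permutes {1..n} \<longrightarrow> f P = f (P \<circ> \<sigma>))"

definition dictatorship :: "'a::finite pref set \<Rightarrow> nat \<Rightarrow> 'a scf \<Rightarrow> bool" where
  "dictatorship D n f \<longleftrightarrow> (\<exists>i\<in>{1..n}. \<forall>P\<in>profiles D n. f P = peak (P i))"

definition non_dictatorial :: "'a::finite pref set \<Rightarrow> bool" where
  "non_dictatorial D \<longleftrightarrow>
     (\<exists>n\<ge>2. \<exists>f. is_rule D n f \<and> strategy_proof D n f \<and> \<not> dictatorship D n f)"

definition tops_only_domain :: "'a::finite pref set \<Rightarrow> bool" where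
  "tops_only_domain D \<longleftrightarrow>
     (\<forall>n\<ge>2. \<forall>f. is_rule D n f \<and> strategy_proof D n f \<longrightarrow> tops_only D n f)"


subsection \<open>Graphs and trees on the alternatives\<close>

text \<open>An undirected simple graph on the alternatives is a symmetric irreflexive relation.\<close>

type_synonym 'a graph = "'a \<Rightarrow> 'a \<Rightarrow> bool"

definition path_between :: "'a graph \<Rightarrow> 'a \<Rightarrow> 'a \<Rightarrow> 'a list \<Rightarrow> bool" where
  "path_between E x y p \<longleftrightarrow>
     p \<noteq> [] \<and> hd p = x \<and> last p = y \<and> distinct p \<and> successively E p"

definition graph_connected :: "'a graph \<Rightarrow> bool" where
  "graph_connected E \<longleftrightarrow> (\<forall>x y. \<exists>p. path_between E x y p)"

definition tree :: "'a graph \<Rightarrow> bool" where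
  "tree T \<longleftrightarrow> symp T \<and> irreflp T \<and> (\<forall>x y. \<exists>!p. path_between T x y p)"

definition tree_path :: "'a graph \<Rightarrow> 'a \<Rightarrow> 'a \<Rightarrow> 'a set" where
  "tree_path T x y = set (THE p. path_between T x y p)"

definition beyond :: "'a graph \<Rightarrow> 'a \<Rightarrow> 'a \<Rightarrow> 'a set" where \<comment> \<open>\<open>A\<close> superscript \<open>x \<rightharpoonup> y\<close>\<close>
  "beyond T x y = {z. x \<in> tree_path T z y}"

definition projection :: "'a graph \<Rightarrow> 'a \<Rightarrow> 'a set \<Rightarrow> 'a" where
  "projection T c S = (THE v. v \<in> S \<and> (\<forall>u\<in>S. v \<in> tree_path T c u))"

definition dual_thresholds :: "'a graph \<Rightarrow> 'a \<Rightarrow> 'a \<Rightarrow> bool" where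
  "dual_thresholds T a b \<longleftrightarrow>
     a \<noteq> b \<and> (\<forall>c. c \<notin> tree_path T a b \<longrightarrow> projection T c (tree_path T a b) \<in> {a, b})"


subsection \<open>Unidimensional domains\<close>

definition adjacent :: "'a::finite pref set \<Rightarrow> 'a graph" where
  "adjacent D a b \<longleftrightarrow> a \<noteq> b \<and>
     (\<exists>P\<in>D. \<exists>Q\<in>D. ranked 1 P = a \<and> ranked 2 Q = a \<and> ranked 1 Q = b \<and> ranked 2 P = b \<and>
        (\<forall>k\<in>{3..CARD('a)}. ranked k P = ranked k Q))"

definition neighbors :: "'a graph \<Rightarrow> 'a \<Rightarrow> 'a set" where
  "neighbors E x = {y. E x y}"

definition leaves :: "'a graph \<Rightarrow> 'a set" where
  "leaves E = {x. card (neighbors E x) = 1}"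

definition completely_reversed :: "'a pref \<Rightarrow> 'a pref \<Rightarrow> bool" where
  "completely_reversed P Q \<longleftrightarrow> (\<forall>a b. a \<noteq> b \<longrightarrow> ((a, b) \<in> P \<longleftrightarrow> (b, a) \<in> Q))"

definition diversity :: "'a pref set \<Rightarrow> bool" where
  "diversity D \<longleftrightarrow> (\<exists>P\<in>D. \<exists>Q\<in>D. completely_reversed P Q)"

definition seconds :: "'a::finite pref set \<Rightarrow> 'a \<Rightarrow> 'a set" where
  "seconds D a = ranked 2 ` with_peak D a"

definition leaf_symmetry :: "'a::finite pref set \<Rightarrow> bool" where
  "leaf_symmetry D \<longleftrightarrow>
     (\<forall>x\<in>leaves (adjacent D). card (seconds D x) > 1 \<longrightarrow>
        (\<exists>z\<in>seconds D x. z \<notin> neighbors (adjacent D) x \<and> x \<in> seconds D z))"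

definition unidimensional :: "'a::finite pref set \<Rightarrow> bool" where
  "unidimensional D \<longleftrightarrow> graph_connected (adjacent D) \<and> diversity D \<and> leaf_symmetry D"


subsection \<open>The line induced by two completely reversed preferences\<close>

definition labelling :: "'a::finite pref \<Rightarrow> 'a pref \<Rightarrow> (nat \<Rightarrow> 'a) \<Rightarrow> bool" where
  "labelling Pl Pu a \<longleftrightarrow> bij_betw a {1..CARD('a)} UNIV \<and>
     (\<forall>k\<in>{1..<CARD('a)}. (a k, a (k + 1)) \<in> Pl \<and> (a (k + 1), a k) \<in> Pu)"

definition line :: "(nat \<Rightarrow> 'a::finite) \<Rightarrow> 'a graph" where
  "line a x y \<longleftrightarrow> (\<exists>k\<in>{1..<CARD('a)}. {x, y} = {a k, a (k + 1)})"


subsection \<open>Single-peaked and hybrid domains\<close>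

definition SP_prefs :: "'a::finite graph \<Rightarrow> 'a pref set" where
  "SP_prefs T = {P. linear_order P \<and>
     (\<forall>a b. a \<noteq> b \<longrightarrow> a \<in> tree_path T (peak P) b \<longrightarrow> (a, b) \<in> P)}"

definition single_peaked_domain :: "'a::finite pref set \<Rightarrow> 'a graph \<Rightarrow> bool" where
  "single_peaked_domain D T \<longleftrightarrow>
     tree T \<and> D \<subseteq> SP_prefs T \<and> graph_connected (adjacent D)"

definition hybrid_prefs :: "'a::finite graph \<Rightarrow> 'a \<Rightarrow> 'a \<Rightarrow> 'a pref set" where
  "hybrid_prefs T a b = {P. linear_order P \<and>
     (\<forall>y z. y \<noteq> z \<longrightarrow>
        (y \<in> beyond T a b \<and> z \<in> beyond T a b) \<or> (y \<in> beyond T b a \<and> z \<in> beyond T b a) \<longrightarrow>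
        y \<in> tree_path T (peak P) z \<longrightarrow> (y, z) \<in> P) \<and>
     (peak P \<in> beyond T a b - {a} \<longrightarrow> best P (tree_path T a b) = a) \<and>
     (peak P \<in> beyond T b a - {b} \<longrightarrow> best P (tree_path T a b) = b)}"

definition hybrid_domain :: "'a::finite pref set \<Rightarrow> 'a graph \<Rightarrow> 'a \<Rightarrow> 'a \<Rightarrow> bool" where
  "hybrid_domain D T a b \<longleftrightarrow>
     tree T \<and> dual_thresholds T a b \<and>
     D \<subseteq> hybrid_prefs T a b \<and> graph_connected (adjacent D) \<and>
     \<not> (\<exists>T' a' b'. tree T' \<and> dual_thresholds T' a' b' \<and> D \<subseteq> hybrid_prefs T' a' b' \<and>
          tree_path T' a' b' \<subset> tree_path T a b) \<and>
     card (tree_path T a b) \<ge> 3"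

definition non_degenerate_hybrid_domain ::
    "'a::finite pref set \<Rightarrow> 'a graph \<Rightarrow> 'a \<Rightarrow> 'a \<Rightarrow> bool" where
  "non_degenerate_hybrid_domain D T a b \<longleftrightarrow>
     hybrid_domain D T a b \<and> (beyond T a b \<noteq> {a} \<or> beyond T b a \<noteq> {b})"

end

theory Submission
  imports Defs
begin

text \<open>Fix the peak \<open>z\<close> of one of two voters. Along an edge \<open>x \<sim> y\<close> of the adjacency graph a
  strategy-proof tops-only rule either does not react to the other voter moving from \<open>x\<close> to \<open>y\<close>, or
  it follows the move. Comparing the four values on an edge, either all edges
  are dictated by the same voter, and then the rule is a dictatorship, or some edge \<open>u \<sim> v\<close> selects \<open>v\<close>
  in both orders. The part of the graph behind such an edge can be pruned until \<open>u\<close> is a leaf \<open>l\<close>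
  with neighbor \<open>w\<close>, and then \<open>w\<close> comes right after \<open>l\<close> in every preference with peak \<open>l\<close>. Therefore
  letting the second voter choose between \<open>l\<close> and \<open>w\<close> whenever the first voter, otherwise a
  dictator, has peak \<open>l\<close> is strategy-proof. As all rules are tops-only, every preference with
  another peak ranks \<open>w\<close> above \<open>l\<close>, and the completely reversed preferences force \<open>l\<close> to be an end of
  the line. This peels one alternative off the line, so the domain is hybrid. An anonymous rule
  cannot be dictatorial on any remaining segment, so it allows the peeling to continue until the
  domain is single-peaked.\<close>

section \<open>Preferences and adjacency\<close>

lemma lin_refl: "linear_order P \<Longrightarrow> (x, x) \<in> P"
  by (simp add: linear_order_on_def partial_order_on_def preorder_on_def refl_on_def)

lemma lin_trans: "linear_order P \<Longrightarrow> (x, y) \<in> P \<Longrightarrow> (y, z) \<in> P \<Longrightarrow> (x, z) \<in> P"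
  by (meson linear_order_on_def partial_order_on_def preorder_on_def transD)

lemma lin_antisym: "linear_order P \<Longrightarrow> (x, y) \<in> P \<Longrightarrow> (y, x) \<in> P \<Longrightarrow> x = y"
  by (meson linear_order_on_def partial_order_on_def antisymD)

lemma lin_total: "linear_order P \<Longrightarrow> (x, y) \<in> P \<or> (y, x) \<in> P"
  by (cases "x = y") (auto simp: lin_refl linear_order_on_def total_on_def)

definition rk :: "'a::finite pref \<Rightarrow> 'a \<Rightarrow> nat" where
  "rk P x = card {y. (y, x) \<in> P}"

lemma rk_le_iff:
  assumes "linear_order P"
  shows "(x, y) \<in> P \<longleftrightarrow> rk P x \<le> rk P y"
proof
  assume "(x, y) \<in> P"
  then show "rk P x \<le> rk P y"
    unfolding rk_def by (auto intro!: card_mono dest: lin_trans[OF assms])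
next
  assume le: "rk P x \<le> rk P y"
  show "(x, y) \<in> P"
  proof (rule ccontr)
    assume "(x, y) \<notin> P"
    with lin_total[OF assms] have "(y, x) \<in> P" by blast
    then have "{z. (z, y) \<in> P} \<subset> {z. (z, x) \<in> P}"
      using \<open>(x, y) \<notin> P\<close> lin_trans[OF assms] lin_refl[OF assms] by blast
    then have "rk P y < rk P x" unfolding rk_def by (simp add: psubset_card_mono)
    with le show False by simp
  qed
qed

lemma rk_inj: "linear_order P \<Longrightarrow> rk P x = rk P y \<longleftrightarrow> x = y"
  by (metis lin_antisym order_refl rk_le_iff)

lemma rk_bij:
  fixes P :: "'a::finite pref"
  assumes "linear_order P"
  shows "bij_betw (rk P) UNIV {1..CARD('a)}"
proof -
  have inj: "inj (rk P)" by (auto simp: inj_def rk_inj[OF assms])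
  have "rk P x \<in> {1..CARD('a)}" for x
  proof -
    have "x \<in> {y. (y, x) \<in> P}" using lin_refl[OF assms] by simp
    then have "0 < rk P x" unfolding rk_def by (auto simp: card_gt_0_iff)
    moreover have "rk P x \<le> CARD('a)" unfolding rk_def by (simp add: card_mono)
    ultimately show ?thesis by simp
  qed
  then have "range (rk P) = {1..CARD('a)}"
    using card_image[OF inj] by (intro card_subset_eq) auto
  with inj show ?thesis by (simp add: bij_betw_def)
qed

lemma ranked_iff:
  fixes P :: "'a::finite pref"
  assumes "linear_order P" "1 \<le> k" "k \<le> CARD('a)"
  shows "ranked k P = x \<longleftrightarrow> rk P x = k"
proof -
  have "k \<in> rk P ` UNIV" using rk_bij[OF assms(1)] assms(2,3) by (auto simp: bij_betw_def)
  then obtain x0 where x0: "rk P x0 = k" by auto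
  have "ranked k P = x0"
    unfolding ranked_def rk_def[symmetric] using x0 rk_inj[OF assms(1)] by (intro the_equality) auto
  then show ?thesis using x0 rk_inj[OF assms(1)] by metis
qed

lemma rk_ge_1:
  fixes P :: "'a::finite pref"
  assumes "linear_order P"
  shows "1 \<le> rk P x" "rk P x \<le> CARD('a)"
  using rk_bij[OF assms] by (auto simp: bij_betw_def)

lemma rk_peak:
  assumes "linear_order P"
  shows "rk P (peak P) = 1"
  using ranked_iff[OF assms, of 1 "peak P"] by (simp add: Suc_leI)

lemma peak_best: "linear_order P \<Longrightarrow> (peak P, y) \<in> P"
  by (metis rk_peak rk_ge_1(1) rk_le_iff)

lemma best_exists:
  fixes P :: "'a::finite pref"
  assumes "linear_order P" "B \<noteq> {}"
  obtains z where "z \<in> B" "\<And>y. y \<in> B \<Longrightarrow> (z, y) \<in> P"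
proof -
  obtain z where "z \<in> B" "\<And>y. y \<in> B \<Longrightarrow> rk P z \<le> rk P y"
    using arg_min_if_finite[of B "rk P"] assms(2) by (metis finite linorder_not_le)
  then show thesis using that rk_le_iff[OF assms(1)] by blast
qed

lemma best_eqI:
  assumes "linear_order P" "z \<in> B" "\<And>y. y \<in> B \<Longrightarrow> (z, y) \<in> P"
  shows "best P B = z"
  unfolding best_def using assms(2,3) lin_antisym[OF assms(1)] by (intro the_equality) auto

lemma best_in:
  fixes P :: "'a::finite pref"
  assumes "linear_order P" "y \<in> B"
  shows "(best P B, y) \<in> P"
proof -
  obtain z where "z \<in> B" "\<And>y. y \<in> B \<Longrightarrow> (z, y) \<in> P"
    using best_exists[OF assms(1), of B] assms(2) by auto
  then show ?thesis using best_eqI[OF assms(1)] assms(2) by metis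
qed

section \<open>Connected adjacency graphs\<close>

lemma successively_rtranclp: "successively E p \<Longrightarrow> p \<noteq> [] \<Longrightarrow> E\<^sup>*\<^sup>* (hd p) (last p)"
proof (induction p)
  case (Cons x p)
  show ?case
  proof (cases p)
    case (Cons y q)
    with Cons.IH Cons.prems have "E x y" "E\<^sup>*\<^sup>* y (last p)" by auto
    then show ?thesis using Cons by (simp add: converse_rtranclp_into_rtranclp)
  qed simp
qed simp

locale connected_domain =
  fixes D :: "'a::finite pref set"
  assumes linear: "P \<in> D \<Longrightarrow> linear_order P"
    and connected: "graph_connected (adjacent D)"
    and two_alternatives: "CARD('a) \<ge> 2"
begin

lemmas refl = lin_refl[OF linear]
  and trans = lin_trans[OF linear]
  and antisym = lin_antisym[OF linear]
  and total = lin_total[OF linear]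
  and peak_top = peak_best[OF linear]

text \<open>Equal ranks from 3 on become agreement on every pair except \<open>{x, y}\<close>. In
  this form the incentives at \<open>P\<close> and at \<open>Q\<close> can be played off against
  each other.\<close>

lemma adjacentE:
  assumes "adjacent D x y"
  obtains P Q where "P \<in> D" "Q \<in> D" "x \<noteq> y" "peak P = x" "peak Q = y"
    "\<And>z. z \<noteq> x \<Longrightarrow> (y, z) \<in> P" "\<And>z. z \<noteq> y \<Longrightarrow> (x, z) \<in> Q"
    "\<And>z w. {z, w} \<noteq> {x, y} \<Longrightarrow> (z, w) \<in> P \<longleftrightarrow> (z, w) \<in> Q"
proof -
  from assms obtain P Q where PQ: "P \<in> D" "Q \<in> D" "x \<noteq> y"
    "ranked 1 P = x" "ranked 2 Q = x" "ranked 1 Q = y" "ranked 2 P = y"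
    "\<And>k. k \<in> {3..CARD('a)} \<Longrightarrow> ranked k P = ranked k Q"
    unfolding adjacent_def by blast
  note linP = linear[OF PQ(1)] and linQ = linear[OF PQ(2)]
  have rks: "rk P x = 1" "rk P y = 2" "rk Q y = 1" "rk Q x = 2"
    using PQ(4-7) ranked_iff[OF linP] ranked_iff[OF linQ] two_alternatives by auto
  have others: "rk P z = rk Q z \<and> 3 \<le> rk P z" if "z \<noteq> x" "z \<noteq> y" for z
  proof -
    have "rk P z \<noteq> 1" "rk P z \<noteq> 2"
      using rks(1,2) rk_inj[OF linP] that by metis+
    then have 3: "3 \<le> rk P z" using rk_ge_1[OF linP, of z] by linarith
    have "ranked (rk P z) P = z"
      using ranked_iff[OF linP] rk_ge_1[OF linP, of z] by blast
    then have "ranked (rk P z) Q = z" using PQ(8) 3 rk_ge_1[OF linP, of z] by auto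
    then show ?thesis using ranked_iff[OF linQ] rk_ge_1[OF linP, of z] 3 by auto
  qed
  show thesis
  proof (rule that[OF PQ(1-3,4,6)])
    show "(y, z) \<in> P" if "z \<noteq> x" for z
      using others[of z] that rks by (cases "z = y") (auto simp: rk_le_iff[OF linP])
    show "(x, z) \<in> Q" if "z \<noteq> y" for z
      using others[of z] that rks by (cases "z = x") (auto simp: rk_le_iff[OF linQ])
    show "(z, w) \<in> P \<longleftrightarrow> (z, w) \<in> Q" if "{z, w} \<noteq> {x, y}" for z w
      using others[of z] others[of w] that rks
      unfolding rk_le_iff[OF linP] rk_le_iff[OF linQ]
      by (cases "z = x"; cases "z = y"; cases "w = x"; cases "w = y") auto
  qed
qed

lemma adjacent_sym: "adjacent D x y \<Longrightarrow> adjacent D y x"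
  unfolding adjacent_def by metis

lemma adjacent_irrefl: "\<not> adjacent D x x"
  by (simp add: adjacent_def)

lemma reachable: "(adjacent D)\<^sup>*\<^sup>* x y"
  using connected unfolding graph_connected_def path_between_def
  by (metis successively_rtranclp)

lemma other_exists: "\<exists>y :: 'a. y \<noteq> x"
proof (rule ccontr)
  assume "\<not> ?thesis"
  then have "UNIV = {x}" by auto
  then show False using two_alternatives by (auto dest!: arg_cong[where f = card])
qed

text \<open>A connected graph with at least two vertices has an edge at each vertex, and the ends of
  an edge are peaks.\<close>

lemma peak_surj: "\<exists>P\<in>D. peak P = x"
proof -
  obtain y where "y \<noteq> x" using other_exists by blast
  with reachable[of x y] obtain z where "adjacent D x z"
    by (metis converse_rtranclpE)
  then show ?thesis by (metis adjacentE)
qed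

end

section \<open>Two-voter functions along the edges of a graph\<close>

text \<open>The arrow points to the winner: \<open>v\<close> is chosen no matter which voter reports
  it, so neither voter dictates the edge.\<close>

definition oriented :: "'a graph \<Rightarrow> ('a \<Rightarrow> 'a \<Rightarrow> 'a) \<Rightarrow> 'a \<Rightarrow> 'a \<Rightarrow> bool" where
  "oriented E g u v \<longleftrightarrow> E u v \<and> g u v = v \<and> g v u = v"

text \<open>Graph-theoretic extract of strategy-proofness: when a voter moves along an edge, the
  outcome stays or follows that voter. \<open>E\<close> will be the adjacency graph induced on
  \<open>M\<close>.\<close>

locale edge_rule =
  fixes E :: "'a graph" and M :: "'a set" and g :: "'a \<Rightarrow> 'a \<Rightarrow> 'a"
  assumes sym: "E x y \<Longrightarrow> E y x"
    and irrefl: "\<not> E x x"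
    and in_M: "E x y \<Longrightarrow> x \<in> M"
    and conn: "x \<in> M \<Longrightarrow> y \<in> M \<Longrightarrow> E\<^sup>*\<^sup>* x y"
    and finite_M: "finite M"
    and left: "E x y \<Longrightarrow> z \<in> M \<Longrightarrow> g x z = g y z \<or> g x z = x \<and> g y z = y"
    and right: "E x y \<Longrightarrow> z \<in> M \<Longrightarrow> g z x = g z y \<or> g z x = x \<and> g z y = y"
    and idem: "x \<in> M \<Longrightarrow> g x x = x"
begin

lemma flip: "edge_rule E M (\<lambda>x y. g y x)"
  by unfold_locales (use sym irrefl in_M conn finite_M left right idem in blast)+

lemma in_M': "E x y \<Longrightarrow> y \<in> M"
  using in_M sym by blast

lemma oriented_flip: "oriented E (\<lambda>x y. g y x) u v \<longleftrightarrow> oriented E g u v"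
  by (auto simp: oriented_def)

section \<open>The vertices behind an oriented edge\<close>

definition cone :: "'a \<Rightarrow> 'a \<Rightarrow> 'a set" where
  "cone v u = {x. (\<lambda>x y. E x y \<and> x \<noteq> v \<and> y \<noteq> v)\<^sup>*\<^sup>* u x}"

lemma cone_self: "u \<in> cone v u"
  by (simp add: cone_def)

lemma cone_step: "x \<in> cone v u \<Longrightarrow> E x y \<Longrightarrow> x \<noteq> v \<Longrightarrow> y \<noteq> v \<Longrightarrow> y \<in> cone v u"
  by (auto simp: cone_def intro: rtranclp.rtrancl_into_rtrancl)

lemma cone_induct [consumes 1, case_names self step]:
  assumes "x \<in> cone v u" "Q u"
    and "\<And>x y. x \<in> cone v u \<Longrightarrow> Q x \<Longrightarrow> E x y \<Longrightarrow> x \<noteq> v \<Longrightarrow> y \<noteq> v \<Longrightarrow> Q y"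
  shows "Q x"
proof -
  have "(\<lambda>x y. E x y \<and> x \<noteq> v \<and> y \<noteq> v)\<^sup>*\<^sup>* u x" using assms(1) by (simp add: cone_def)
  then show ?thesis
    by (induction rule: rtranclp_induct) (use assms(2,3) in \<open>auto simp: cone_def\<close>)
qed

text \<open>Moving along an edge that avoids \<open>v\<close> cannot change an outcome
  \<open>v\<close>, since only an outcome equal to the moving voter's report can change.\<close>

lemma cone_value:
  assumes "oriented E g u v" "x \<in> cone v u"
  shows "x \<noteq> v \<and> x \<in> M \<and> g x v = v \<and> g v x = v"
  using assms(2)
proof (induction rule: cone_induct)
  case self
  show ?case using assms(1) irrefl in_M by (auto simp: oriented_def)
next
  case (step x y)
  have "v \<in> M" using assms(1) in_M' by (auto simp: oriented_def)
  with step left[of x y v] right[of x y v] in_M' show ?case by metis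
qed

text \<open>If \<open>y\<close> were chosen against \<open>u\<close>, then moving the second voter
  from \<open>u\<close> to \<open>v\<close> would change the outcome from \<open>y\<close> to
  \<open>v\<close> by \<open>cone_value\<close>, although it was not \<open>u\<close>
  before.\<close>

lemma cone_value_base:
  assumes o: "oriented E g u v" and x: "x \<in> cone v u"
  shows "g x u = u"
  using x
proof (induction rule: cone_induct)
  case self
  show ?case using o in_M idem by (auto simp: oriented_def)
next
  case (step x y)
  have uv: "u \<in> M" "E u v" using o in_M by (auto simp: oriented_def)
  have y: "y \<in> cone v u" using step cone_step by blast
  show ?case
  proof (rule ccontr)
    assume ne: "g y u \<noteq> u"
    with step left[of x y u] uv have *: "g y u = y" by metis
    with right[of u v y] uv cone_value[OF o y] ne show False by metis
  qed
qed

lemma cone_value_base': "oriented E g u v \<Longrightarrow> x \<in> cone v u \<Longrightarrow> g u x = u"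
  using edge_rule.cone_value_base[OF flip, of u v x] oriented_flip
  by (simp add: edge_rule.cone_def[OF flip] cone_def)

text \<open>With the second voter at \<open>u\<close>, moving the first from \<open>x\<close> to
  \<open>v\<close> changes the outcome from \<open>u\<close> to \<open>v\<close>. It must have
  followed the voter, so \<open>x = u\<close>: the cone is left only through
  \<open>u\<close>.\<close>

lemma cone_gate:
  assumes o: "oriented E g u v" and x: "x \<in> cone v u" "E x v"
  shows "x = u"
proof -
  have "g x u = u" "g v u = v" "u \<noteq> v" "u \<in> M"
    using cone_value_base[OF o x(1)] o irrefl in_M by (auto simp: oriented_def)
  with left[of x v u] x show ?thesis by metis
qed

text \<open>The values on the cone orient every other edge at \<open>u\<close> towards
  \<open>u\<close>. The cone behind such an edge avoids \<open>u\<close> and, by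
  \<open>cone_gate\<close>, never gets past \<open>v\<close>, so it is strictly smaller.\<close>

lemma oriented_inwards:
  assumes o: "oriented E g u v" and w: "E w u" "w \<noteq> v"
  shows "oriented E g w u" "cone u w \<subset> cone v u"
proof -
  have uv: "u \<noteq> v" using o irrefl by (auto simp: oriented_def)
  have wc: "w \<in> cone v u" using cone_step[OF cone_self] w sym uv by blast
  show "oriented E g w u"
    unfolding oriented_def using w cone_value_base[OF o wc] cone_value_base'[OF o wc] by simp
  have wu: "w \<noteq> u" using w irrefl by blast
  have "x \<in> cone v u \<and> x \<noteq> u" if "x \<in> cone u w" for x
    using that
  proof (induction rule: cone_induct)
    case self
    show ?case using wc wu by simp
  next
    case (step x y)
    then have "y \<noteq> v" using cone_gate[OF o] by blast
    then show ?case using step cone_step cone_value[OF o] by blast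
  qed
  then show "cone u w \<subset> cone v u" using cone_self by blast
qed

text \<open>Going inwards shrinks a finite cone each time, and the descent can only stop at a
  leaf.\<close>

lemma oriented_leaf:
  assumes "oriented E g u v"
  shows "\<exists>l w. oriented E g l w \<and> (\<forall>y. E l y \<longrightarrow> y = w)"
  using assms
proof (induction "card (cone v u)" arbitrary: u v rule: less_induct)
  case less
  show ?case
  proof (cases "\<forall>y. E u y \<longrightarrow> y = v")
    case False
    then obtain w where w: "E w u" "w \<noteq> v" using sym by blast
    have "finite (cone v u)"
      using cone_value[OF less.prems] finite_M by (meson finite_subset subsetI)
    then have "card (cone u w) < card (cone v u)"
      using oriented_inwards[OF less.prems w] psubset_card_mono by blast
    with less.hyps oriented_inwards(1)[OF less.prems w] show ?thesis by blast
  qed (use less.prems in blast)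
qed

lemma range_M:
  assumes "x \<in> M" "y \<in> M"
  shows "g x y \<in> M"
  using conn[OF assms(2,1)]
proof (induction rule: rtranclp_induct)
  case (step x z)
  show ?case using left[OF step(2) assms(2)] in_M'[OF step(2)] step(3) by auto
qed (simp add: idem assms)

text \<open>With the first voter at \<open>l\<close>, let the second walk from \<open>w\<close> to
  \<open>z\<close>. The outcome can become \<open>l\<close> only when the walk steps on
  \<open>l\<close>, and from there the only edge leads back to \<open>w\<close>, where the outcome
  is \<open>w\<close>.\<close>

lemma leaf_value:
  assumes o: "oriented E g l w" and leaf: "\<And>y. E l y \<Longrightarrow> y = w"
    and z: "z \<in> M" "z \<noteq> l"
  shows "g l z \<noteq> l" "g l z = g w z"
proof -
  have lw: "E l w" "g l w = w" using o by (auto simp: oriented_def)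
  have lw': "l \<noteq> w" "w \<in> M" "l \<in> M" using lw(1) irrefl in_M in_M' by blast+
  have "z \<noteq> l \<longrightarrow> g l z \<noteq> l"
    using conn[OF lw'(2) z(1)]
  proof (induction rule: rtranclp_induct)
    case (step y z)
    show ?case
    proof (cases "y = l")
      case True
      then show ?thesis using step(2) leaf lw(2) lw'(1) by metis
    next
      case False
      then show ?thesis using right[OF step(2) lw'(3)] step(3) by auto
    qed
  qed (use lw(2) lw'(1) in simp)
  with z(2) show *: "g l z \<noteq> l" by simp
  show "g l z = g w z" using left[OF lw(1) z(1)] * by simp
qed

lemma edge_value: "E u v \<Longrightarrow> g u v = u \<or> g u v = v"
  using left[of u v v] idem[of v] in_M'[of u v] by auto

text \<open>Without oriented edges each edge is dictated by one voter. Edges that share a vertex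
  have the same dictator, and connectedness extends this to the whole graph.\<close>

lemma dictated:
  assumes none: "\<And>u v. \<not> oriented E g u v"
  shows "(\<forall>x\<in>M. \<forall>y\<in>M. g x y = x) \<or> (\<forall>x\<in>M. \<forall>y\<in>M. g x y = y)"
proof -
  define one where "one u v \<longleftrightarrow> g u v = u \<and> g v u = v" for u v
  define two where "two u v \<longleftrightarrow> g u v = v \<and> g v u = u" for u v
  have cases: "one u v \<or> two u v" if "E u v" for u v
    using edge_value[OF that] edge_value[OF sym[OF that]] none[of u v] none[of v u] that sym[OF that]
    unfolding oriented_def one_def two_def by auto
  \<comment> \<open>For \<open>u \<noteq> w\<close>, the first voter's move from \<open>u\<close> to
    \<open>v\<close> against \<open>w\<close> would change the outcome from \<open>u\<close> to
    \<open>w\<close>, neither staying nor following. For \<open>u = w\<close> the assumptions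
    contradict each other directly.\<close>
  have clash: False if "E u v" "E v w" "one u v" "two v w" for u v w
  proof -
    have ne: "u \<noteq> v" "v \<noteq> w" using that irrefl by blast+
    have M: "u \<in> M" "w \<in> M" using that in_M in_M' by blast+
    have "g u w = u" using right[of v w u] that(2,3) M ne unfolding one_def by metis
    moreover have "g v w = w" using that(4) unfolding two_def by simp
    ultimately show False
      using left[of u v w] that M ne unfolding one_def two_def by metis
  qed
  have same: "one v w" if "E u v" "E v w" "one u v" for u v w
    using clash[OF that] cases[OF that(2)] by blast
  have one_sym: "one v u" if "one u v" for u v using that by (auto simp: one_def)
  have spread: "\<forall>z. E y z \<longrightarrow> one y z" if "E u v" "one u v" "y \<in> M" for u v y
    using conn[OF in_M[OF that(1)] that(3)]
  proof (induction rule: rtranclp_induct)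
    case base
    show ?case using same[OF sym[OF that(1)] _ one_sym[OF that(2)]] by blast
  next
    case (step y z)
    then show ?case using same by blast
  qed
  have walk: "g x y = x" if "\<And>u v. E u v \<Longrightarrow> one u v" "x \<in> M" "y \<in> M" for x y
    using conn[OF that(2,3)]
  proof (induction rule: rtranclp_induct)
    case (step y z)
    then show ?case using right[of y z x] that(1,2) unfolding one_def by metis
  qed (simp add: idem that)
  have walk': "g x y = y" if "\<And>u v. E u v \<Longrightarrow> two u v" "x \<in> M" "y \<in> M" for x y
    using conn[OF that(3,2)]
  proof (induction rule: rtranclp_induct)
    case (step x z)
    then show ?case using left[of x z y] that(1,3) unfolding two_def by metis
  qed (simp add: idem that)
  show ?thesis
  proof (cases "\<exists>u v. E u v \<and> one u v")
    case True
    then have "one u v" if "E u v" for u v using spread in_M that by blast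
    then show ?thesis using walk by blast
  next
    case False
    then have "two u v" if "E u v" for u v using cases that by blast
    then show ?thesis using walk' by blast
  qed
qed

end

section \<open>Rules as functions of the reported peaks\<close>

text \<open>Strategy-proofness for a function of the reported peaks. \<open>F\<close> takes total
  functions, so the first conjunct makes it ignore indices outside \<open>N\<close>; reflexivity of
  \<open>P\<close> covers equal outcomes.\<close>

definition top_sp :: "'a::finite pref set \<Rightarrow> 'i set \<Rightarrow> (('i \<Rightarrow> 'a) \<Rightarrow> 'a) \<Rightarrow> bool" where
  "top_sp D N F \<longleftrightarrow>
     (\<forall>x y. (\<forall>i\<in>N. x i = y i) \<longrightarrow> F x = F y) \<and>
     (\<forall>i\<in>N. \<forall>P\<in>D. \<forall>x y. x i = peak P \<longrightarrow> (F x, F (x(i := y))) \<in> P)"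

lemma top_sp_cong: "top_sp D N F \<Longrightarrow> (\<And>i. i \<in> N \<Longrightarrow> x i = y i) \<Longrightarrow> F x = F y"
  unfolding top_sp_def by blast

definition pair_sp :: "'a::finite pref set \<Rightarrow> ('a \<Rightarrow> 'a \<Rightarrow> 'a) \<Rightarrow> bool" where
  "pair_sp D g \<longleftrightarrow>
     (\<forall>P\<in>D. \<forall>y z. (g (peak P) z, g y z) \<in> P \<and> (g z (peak P), g z y) \<in> P)"

lemma pair_sp_flip: "pair_sp D g \<Longrightarrow> pair_sp D (\<lambda>x y. g y x)"
  by (simp add: pair_sp_def)

context connected_domain
begin

definition adj_on :: "'a set \<Rightarrow> 'a graph" where
  "adj_on M x y \<longleftrightarrow> adjacent D x y \<and> x \<in> M \<and> y \<in> M"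

section \<open>Coalitions acting as single voters\<close>

text \<open>The members switch one after the other. Each still reports \<open>peak P\<close> before
  switching, so no single switch improves the outcome for \<open>P\<close>, and the steps compose by
  transitivity.\<close>

lemma top_sp_coalition:
  assumes F: "top_sp D N F" and N: "finite N" and P: "P \<in> D"
    and S: "\<And>i. i \<in> S \<Longrightarrow> x i = peak P"
  shows "(F x, F (\<lambda>i. if i \<in> S then y else x i)) \<in> P"
proof -
  have "finite (S \<inter> N)" using N by simp
  moreover have "S \<inter> N \<subseteq> S \<inter> N" by simp
  ultimately have "(F x, F (\<lambda>i. if i \<in> S \<inter> N then y else x i)) \<in> P"
  proof (induction rule: finite_subset_induct)
    case empty
    show ?case using refl[OF P] by simp
  next
    case (insert j T)
    let ?x = "\<lambda>i. if i \<in> T then y else x i"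
    have "(F ?x, F (?x(j := y))) \<in> P"
      using F P insert S unfolding top_sp_def by auto
    moreover have "?x(j := y) = (\<lambda>i. if i \<in> insert j T then y else x i)" by auto
    ultimately show ?case using trans[OF P] insert by metis
  qed
  moreover have "F (\<lambda>i. if i \<in> S \<inter> N then y else x i) = F (\<lambda>i. if i \<in> S then y else x i)"
    by (rule top_sp_cong[OF F]) simp
  ultimately show ?thesis by simp
qed

text \<open>A voter who has joined \<open>w\<close> could return to the old report and obtain
  \<open>w\<close>. For a preference with peak \<open>w\<close>, truth can then yield nothing but
  \<open>w\<close>.\<close>

lemma top_sp_move:
  assumes F: "top_sp D N F" and N: "finite N" and w: "F x = w"
  shows "F (\<lambda>i. if i \<in> S then w else x i) = w"
proof -
  obtain Q where Q: "Q \<in> D" "peak Q = w" using peak_surj by blast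
  have "finite (S \<inter> N)" using N by simp
  moreover have "S \<inter> N \<subseteq> S \<inter> N" by simp
  ultimately have "F (\<lambda>i. if i \<in> S \<inter> N then w else x i) = w"
  proof (induction rule: finite_subset_induct)
    case (insert j T)
    let ?x = "\<lambda>i. if i \<in> T then w else x i"
    let ?x' = "\<lambda>i. if i \<in> insert j T then w else x i"
    have "(F ?x', F (?x'(j := ?x j))) \<in> Q"
      using F Q insert unfolding top_sp_def by auto
    moreover have "?x'(j := ?x j) = ?x" by auto
    ultimately have "(F ?x', w) \<in> Q" using insert by metis
    then show ?case using peak_top[OF Q(1), of "F ?x'"] antisym[OF Q(1)] Q(2) by metis
  qed (simp add: w)
  moreover have "F (\<lambda>i. if i \<in> S \<inter> N then w else x i) = F (\<lambda>i. if i \<in> S then w else x i)"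
    by (rule top_sp_cong[OF F]) simp
  ultimately show ?thesis by simp
qed

lemma pair_sp_coalitions:
  assumes F: "top_sp D N F" and N: "finite N" and ST: "S \<inter> T = {}"
  shows "pair_sp D (\<lambda>x y. F (\<lambda>i. if i \<in> S then x else if i \<in> T then y else c i))"
  unfolding pair_sp_def
proof (intro ballI allI conjI)
  fix P y z assume P: "P \<in> D"
  let ?x = "\<lambda>i. if i \<in> S then peak P else if i \<in> T then z else c i"
  have "(F ?x, F (\<lambda>i. if i \<in> S then y else ?x i)) \<in> P"
    by (rule top_sp_coalition[OF F N P]) simp
  moreover have "(\<lambda>i. if i \<in> S then y else ?x i) = (\<lambda>i. if i \<in> S then y else if i \<in> T then z else c i)"
    by auto
  ultimately show "(F ?x, F (\<lambda>i. if i \<in> S then y else if i \<in> T then z else c i)) \<in> P" by simp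
  let ?x = "\<lambda>i. if i \<in> S then z else if i \<in> T then peak P else c i"
  have "(F ?x, F (\<lambda>i. if i \<in> T then y else ?x i)) \<in> P"
    by (rule top_sp_coalition[OF F N P]) (use ST in auto)
  moreover have "(\<lambda>i. if i \<in> T then y else ?x i) = (\<lambda>i. if i \<in> S then z else if i \<in> T then y else c i)"
    by (rule ext) (use ST in auto)
  ultimately show "(F ?x, F (\<lambda>i. if i \<in> S then z else if i \<in> T then y else c i)) \<in> P" by simp
qed

text \<open>\<open>P\<close> and \<open>Q\<close> agree on the two outcomes unless these are
  \<open>x\<close> and \<open>y\<close>, so antisymmetry makes them equal. In the exceptional case
  \<open>P\<close> has \<open>x\<close> on top, which excludes an outcome moving backwards.\<close>

lemma pair_sp_edge:
  assumes g: "pair_sp D g" and "adjacent D x y"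
  shows "g x z = g y z \<or> g x z = x \<and> g y z = y"
proof -
  obtain P Q where PQ: "P \<in> D" "Q \<in> D" "x \<noteq> y" "peak P = x" "peak Q = y"
    "\<And>z w. {z, w} \<noteq> {x, y} \<Longrightarrow> (z, w) \<in> P \<longleftrightarrow> (z, w) \<in> Q"
    using adjacentE[OF assms(2)] by metis
  have 1: "(g x z, g y z) \<in> P" and 2: "(g y z, g x z) \<in> Q"
    using g PQ(1,2,4,5) unfolding pair_sp_def by auto
  show ?thesis
  proof (cases "{g y z, g x z} = {x, y}")
    case True
    then consider "g x z = x \<and> g y z = y" | "g x z = y \<and> g y z = x"
      by (auto simp: doubleton_eq_iff)
    then show ?thesis
    proof cases
      case 2
      then show ?thesis using 1 peak_top[OF PQ(1), of y] antisym[OF PQ(1)] PQ(4) by auto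
    qed simp
  next
    case False
    then show ?thesis using 1 2 PQ(6) antisym[OF PQ(1)] by blast
  qed
qed

lemma edge_ruleI:
  assumes g: "pair_sp D g" and idem: "\<And>x. x \<in> M \<Longrightarrow> g x x = x"
    and conn: "\<And>x y. x \<in> M \<Longrightarrow> y \<in> M \<Longrightarrow> (adj_on M)\<^sup>*\<^sup>* x y"
  shows "edge_rule (adj_on M) M g"
proof
  show "g x z = g y z \<or> g x z = x \<and> g y z = y" if "adj_on M x y" for x y z
    using pair_sp_edge[OF g] that by (auto simp: adj_on_def)
  show "g z x = g z y \<or> g z x = x \<and> g z y = y" if "adj_on M x y" for x y z
    using pair_sp_edge[OF pair_sp_flip[OF g]] that by (auto simp: adj_on_def)
qed (auto simp: adj_on_def adjacent_sym adjacent_irrefl idem conn)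

text \<open>Split a minimal decisive coalition with at least two members into \<open>T\<close> and \<open>{i}\<close>. Neither
  part is decisive, and nor is the complement, so any two of the three groups are: freezing the
  third group at \<open>u\<close> makes \<open>u\<close> win against its neighbor \<open>v\<close> from either side.\<close>

lemma oriented_or_dictator:
  assumes F: "top_sp D N F" and N: "finite N"
    and unanimous: "\<And>x c. (\<And>i. i \<in> N \<Longrightarrow> x i = c) \<Longrightarrow> F x = c"
    and conn: "\<And>x y. x \<in> M \<Longrightarrow> y \<in> M \<Longrightarrow> (adj_on M)\<^sup>*\<^sup>* x y"
    and uv: "adj_on M u v"
  obtains g x y where "pair_sp D g" "edge_rule (adj_on M) M g" "oriented (adj_on M) g x y"
  | d where "d \<in> N" "\<And>x y. x \<in> M \<Longrightarrow> y \<in> M \<Longrightarrow> F (\<lambda>i. if i = d then x else y) = x"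
proof -
  define g where "g S x y = F (\<lambda>i. if i \<in> S then x else y)" for S x y
  define decisive where "decisive S \<longleftrightarrow> (\<forall>x\<in>M. \<forall>y\<in>M. g S x y = x)" for S
  have uvM: "u \<in> M" "v \<in> M" "u \<noteq> v" using uv adjacent_irrefl by (auto simp: adj_on_def)
  have sp: "pair_sp D (g S)" for S
  proof -
    have eq: "(\<lambda>i. if i \<in> S then x else if i \<in> - S then y else undefined) = (\<lambda>i. if i \<in> S then x else y)" for x y
      by auto
    have "S \<inter> - S = {}" by simp
    from pair_sp_coalitions[OF F N this, of "\<lambda>i. undefined"]
    show ?thesis unfolding g_def eq .
  qed
  have rule: "edge_rule (adj_on M) M (g S)" for S
    by (rule edge_ruleI[OF sp _ conn]) (auto simp: g_def unanimous)
  show thesis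
  proof (cases "\<exists>S x y. oriented (adj_on M) (g S) x y")
    case True
    then show thesis using that(1) sp rule by blast
  next
    case False
    have dec: "decisive S \<or> (\<forall>x\<in>M. \<forall>y\<in>M. g S x y = y)" for S
      using edge_rule.dictated[OF rule] False unfolding decisive_def by blast
    have "decisive N" unfolding decisive_def g_def by (auto intro: unanimous)
    then obtain S where S: "S \<subseteq> N" "decisive S"
      and min: "\<And>T. T \<subseteq> N \<Longrightarrow> decisive T \<Longrightarrow> card S \<le> card T"
      using ex_has_least_nat[of "\<lambda>S. S \<subseteq> N \<and> decisive S" N card] by blast
    have "S \<noteq> {}"
    proof
      assume "S = {}"
      then have "F (\<lambda>i. v) = u" using S(2) uvM unfolding decisive_def g_def by auto
      then show False using unanimous[of "\<lambda>i. v" v] uvM by simp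
    qed
    then obtain i where i: "i \<in> S" by blast
    define T where "T = S - {i}"
    have finS: "finite S" using S(1) N finite_subset by blast
    show thesis
    proof (cases "T = {}")
      case True
      then have "S = {i}" using i T_def by auto
      then show thesis using that(2)[of i] S unfolding decisive_def g_def by auto
    next
      case False
      have "card T < card S" unfolding T_def using card_Diff1_less[OF finS i] .
      then have nT: "\<not> decisive T" using min[of T] S(1) by (auto simp: T_def)
      have "card T > 0" using False finS by (simp add: T_def card_gt_0_iff)
      then have "card {i} < card S" using \<open>card T < card S\<close> by simp
      then have ni: "\<not> decisive {i}" using min[of "{i}"] S(1) i by auto
      define k where "k x y = F (\<lambda>j. if j \<in> T then x else if j \<in> {i} then y else u)" for x y
      have k: "pair_sp D k"
        unfolding k_def by (rule pair_sp_coalitions[OF F N]) (simp add: T_def)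
      have "k x x = g S x u" for x
        unfolding k_def g_def T_def by (rule arg_cong[where f = F]) (use i in auto)
      then have "k x x = x" if "x \<in> M" for x
        using S(2) uvM that unfolding decisive_def by simp
      then have kr: "edge_rule (adj_on M) M k" by (intro edge_ruleI[OF k _ conn])
      have "k u v = g {i} v u"
        unfolding k_def g_def T_def by (rule arg_cong[where f = F]) auto
      then have 1: "k u v = u" using ni dec uvM by metis
      have "k v u = g T v u"
        unfolding k_def g_def T_def by (rule arg_cong[where f = F]) auto
      then have 2: "k v u = u" using nT dec uvM by metis
      have "adj_on M v u" using uv by (simp add: adj_on_def adjacent_sym)
      then have "oriented (adj_on M) k v u" using 1 2 by (simp add: oriented_def)
      then show thesis using that(1) k kr by blast
    qed
  qed
qed

text \<open>Let all voters but \<open>d\<close> report the outcome; it does not change. Those voters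
  now agree, so it equals the report of \<open>d\<close>.\<close>

lemma dictator:
  assumes F: "top_sp D N F" and N: "finite N" and d: "d \<in> N"
    and dict: "\<And>x y. F (\<lambda>i. if i = d then x else y) = x"
  shows "F x = x d"
proof -
  have "F (\<lambda>i. if i \<in> - {d} then F x else x i) = F x"
    by (rule top_sp_move[OF F N]) simp
  moreover have "(\<lambda>i. if i \<in> - {d} then F x else x i) = (\<lambda>i. if i = d then x d else F x)" by auto
  ultimately show ?thesis using dict by metis
qed

text \<open>Swapping gives \<open>d'\<close> the power of \<open>d\<close>. If \<open>d'\<close>
  reports \<open>u\<close> and all others \<open>v\<close>, the outcome is \<open>u\<close>, and it
  stays \<open>u\<close> when everybody except \<open>d\<close> joins \<open>u\<close>. But there
  \<open>d\<close>, facing unanimous others, obtains \<open>v\<close>.\<close>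

lemma no_anonymous_dictator:
  assumes F: "top_sp D N F" and N: "finite N" and d: "d \<in> N" "d' \<in> N" "d' \<noteq> d"
    and dict: "\<And>x y. x \<in> M \<Longrightarrow> y \<in> M \<Longrightarrow> F (\<lambda>i. if i = d then x else y) = x"
    and anon: "\<And>\<sigma> x. \<sigma> permutes N \<Longrightarrow> F (x \<circ> \<sigma>) = F x"
    and M: "u \<in> M" "v \<in> M"
  shows "u = v"
proof -
  have "F ((\<lambda>i. if i = d then u else v) \<circ> transpose d d') = u"
    using anon[OF permutes_swap_id[OF d(1,2)]] dict M by metis
  moreover have "(\<lambda>i. if i = d then u else v) \<circ> transpose d d' = (\<lambda>i. if i = d' then u else v)"
    using d(3) by (auto simp: transpose_def)
  ultimately have 1: "F (\<lambda>i. if i = d' then u else v) = u" by (simp only:)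
  have "F (\<lambda>i. if i = d then v else u)
      = F (\<lambda>i. if i \<in> - {d} then u else (\<lambda>i. if i = d' then u else v) i)"
    by (rule arg_cong[where f = F], rule ext) (use d(3) in simp)
  also have "\<dots> = u" 
    using top_sp_move[where x = "\<lambda>i. if i = d' then u else v" and S = "- {d}" and w = u, OF F N 1] .
  finally have "F (\<lambda>i. if i = d then v else u) = u" .
  then show ?thesis using dict[OF M(2,1)] by (simp only:)
qed

lemma tops_function:
  assumes f: "is_rule D n f" "strategy_proof D n f" "tops_only D n f"
  shows "\<exists>F. (\<forall>P\<in>profiles D n. f P = F (\<lambda>i. peak (P i))) \<and> top_sp D {1..n} F \<and>
    (\<forall>x c. (\<forall>i\<in>{1..n}. x i = c) \<longrightarrow> F x = c) \<and>
    (anonymous D n f \<longrightarrow> (\<forall>\<sigma> x. \<sigma> permutes {1..n} \<longrightarrow> F (x \<circ> \<sigma>) = F x))"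
proof -
  \<comment> \<open>One representative preference per peak turns a vector of peaks into a
    profile.\<close>
  define rep where "rep c = (SOME P. P \<in> D \<and> peak P = c)" for c
  have rep: "rep c \<in> D" "peak (rep c) = c" for c
    using someI_ex[of "\<lambda>P. P \<in> D \<and> peak P = c"] peak_surj[of c] unfolding rep_def by auto
  define prof where "prof x = (\<lambda>i\<in>{1..n}. rep (x i))" for x
  define F where "F x = f (prof x)" for x
  have prof: "prof x \<in> profiles D n" for x
    using rep by (auto simp: prof_def profiles_def)
  have tops: "f P = f Q" if "P \<in> profiles D n" "Q \<in> profiles D n"
    "\<And>i. i \<in> {1..n} \<Longrightarrow> peak (P i) = peak (Q i)" for P Q
    using f(3) that unfolding tops_only_def by blast
  show ?thesis
  proof (intro exI[of _ F] conjI ballI allI impI)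
    show "f P = F (\<lambda>i. peak (P i))" if "P \<in> profiles D n" for P
      unfolding F_def by (rule tops[OF that prof]) (simp add: prof_def rep del: One_nat_def)
    show "F x = c" if "\<forall>i\<in>{1..n}. x i = c" for x c
      using f(1) prof[of x] that unfolding is_rule_def F_def by (simp add: prof_def rep del: One_nat_def)
    show "top_sp D {1..n} F"
      unfolding top_sp_def
    proof (intro conjI allI impI ballI)
      show "F x = F y" if "\<forall>i\<in>{1..n}. x i = y i" for x y
      proof -
        have "prof x = prof y" unfolding prof_def by (rule restrict_ext) (use that in simp)
        then show ?thesis by (simp add: F_def)
      qed
      fix i P x y assume i: "i \<in> {1..n}" "P \<in> D" "x i = peak P"
      have P': "(prof x)(i := P) \<in> profiles D n"
        using prof[of x] i by (auto simp: profiles_def PiE_def extensional_def)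
      \<comment> \<open>\<open>P\<close> need not be the representative of its peak; tops-onlyness
        lets it take that place in the profile.\<close>
      have "f ((prof x)(i := P)) = F x"
        unfolding F_def by (rule tops[OF P' prof]) (use i in \<open>simp add: prof_def rep del: One_nat_def\<close>)
      moreover have "((prof x)(i := P))(i := rep y) = prof (x(i := y))"
        by (rule ext) (use i(1) in \<open>auto simp: prof_def\<close>)
      moreover have "(f ((prof x)(i := P)), f (((prof x)(i := P))(i := rep y))) \<in> P"
        using f(2) P' i rep(1) refl[OF i(2)] unfolding strategy_proof_def by (metis fun_upd_same)
      ultimately show "(F x, F (x(i := y))) \<in> P" by (simp add: F_def)
    qed
    show "F (x \<circ> \<sigma>) = F x" if "anonymous D n f" "\<sigma> permutes {1..n}" for \<sigma> x
    proof -
      have "prof (x \<circ> \<sigma>) = prof x \<circ> \<sigma>"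
        using permutes_in_image[OF that(2)] permutes_not_in[OF that(2)]
        by (auto simp: prof_def fun_eq_iff restrict_def)
      then show ?thesis using that prof[of x] unfolding anonymous_def F_def by metis
    qed
  qed
qed

end

section \<open>Rules that let the second voter choose between two alternatives\<close>

definition gate_choice :: "'a::finite set \<Rightarrow> ('a \<Rightarrow> int) \<Rightarrow> 'a \<Rightarrow> 'a \<Rightarrow> 'a pref \<Rightarrow> 'a pref \<Rightarrow> 'a" where
  "gate_choice I r l w P Q =
     (if peak P \<notin> I then peak P
      else if peak Q \<in> I then (if r (peak P) \<le> r (peak Q) then peak Q else peak P)
      else if (w, l) \<in> Q then w else l)"

text \<open>Here \<open>I\<close> is a tail of the line that ends in \<open>l\<close> and is left through \<open>w\<close>. When the peak of
  the first voter lies in \<open>I\<close> and that of the second voter does not, the outcome depends on how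
  the second voter compares \<open>w\<close> and \<open>l\<close>; in a tops-only domain this comparison is thus
  determined by the peak.\<close>

locale gate = connected_domain +
  fixes I :: "'a set" and r :: "'a \<Rightarrow> int" and l w :: 'a
  assumes tops_only_domain: "tops_only_domain D"
    and l_in: "l \<in> I" and w_notin: "w \<notin> I"
    and l_last: "y \<in> I \<Longrightarrow> r y \<le> r l"
    and inside: "P \<in> D \<Longrightarrow> peak P \<in> I \<Longrightarrow> y \<in> I \<Longrightarrow> z \<in> I \<Longrightarrow>
                   r (peak P) \<le> r y \<Longrightarrow> r y \<le> r z \<Longrightarrow> (y, z) \<in> P"
    and leaving_l: "P \<in> D \<Longrightarrow> peak P \<in> I \<Longrightarrow> z \<notin> I \<Longrightarrow> (l, z) \<in> P"
    and leaving_w: "P \<in> D \<Longrightarrow> peak P \<in> I \<Longrightarrow> z \<notin> I \<Longrightarrow> (w, z) \<in> P"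
    and entering: "P \<in> D \<Longrightarrow> peak P \<notin> I \<Longrightarrow> y \<in> I \<Longrightarrow> (l, y) \<in> P"
begin

abbreviation choice :: "'a pref \<Rightarrow> 'a pref \<Rightarrow> 'a" where
  "choice \<equiv> gate_choice I r l w"

lemma leaving:
  assumes "P \<in> D" "peak P \<in> I" "y \<in> I" "r (peak P) \<le> r y" "z \<notin> I"
  shows "(y, z) \<in> P"
  using trans[OF assms(1) inside[OF assms(1,2,3) l_in assms(4) l_last[OF assms(3)]]
      leaving_l[OF assms(1,2,5)]] .

text \<open>If \<open>peak Q\<close> is outside \<open>I\<close>, a deviation matters only by
  yielding an outsider, which is not above \<open>l\<close> or \<open>w\<close>. If it is inside,
  the outcome is the voter's own peak, or \<open>peak Q\<close> ahead of it, and then deviations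
  only lead further away.\<close>

lemma choice_sp_1:
  assumes P: "P \<in> D" and Q: "Q \<in> D" and P': "P' \<in> D"
  shows "(choice P Q, choice P' Q) \<in> P"
proof (cases "peak P \<in> I")
  case False
  then show ?thesis using peak_top[OF P] by (simp add: gate_choice_def del: One_nat_def)
next
  case PI: True
  show ?thesis
  proof (cases "peak Q \<in> I")
    case False
    then show ?thesis
      using PI leaving_l[OF P PI] leaving_w[OF P PI] refl[OF P]
      by (simp add: gate_choice_def del: One_nat_def)
  next
    case QI: True
    show ?thesis
    proof (cases "r (peak P) \<le> r (peak Q)")
      case True
      then have *: "choice P Q = peak Q" using PI QI by (simp add: gate_choice_def)
      show ?thesis
      proof (cases "peak P' \<in> I")
        case False
        then have "choice P' Q = peak P'" by (simp add: gate_choice_def)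
        then show ?thesis using * leaving[OF P PI QI True False] by simp
      next
        case P'I: True
        then have "choice P' Q \<in> I" "r (peak Q) \<le> r (choice P' Q)"
          using QI by (auto simp: gate_choice_def)
        then show ?thesis using * inside[OF P PI QI _ True] by simp
      qed
    next
      case False
      then have "choice P Q = peak P" using PI QI by (simp add: gate_choice_def)
      then show ?thesis using peak_top[OF P] by simp
    qed
  qed
qed

text \<open>A second voter with peak in \<open>I\<close> gets that peak, or else
  \<open>peak P\<close>, which comes before everything else within reach. A voter with peak outside
  gets the better of \<open>w\<close> and \<open>l\<close>; reporting a peak in \<open>I\<close>
  yields an element of \<open>I\<close>, not above \<open>l\<close> by
  \<open>entering\<close>.\<close>

lemma choice_sp_2:
  assumes P: "P \<in> D" and Q: "Q \<in> D" and Q': "Q' \<in> D"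
  shows "(choice P Q, choice P Q') \<in> Q"
proof (cases "peak P \<in> I")
  case False
  then show ?thesis using refl[OF Q] by (simp add: gate_choice_def)
next
  case PI: True
  show ?thesis
  proof (cases "peak Q \<in> I")
    case QI: True
    show ?thesis
    proof (cases "r (peak P) \<le> r (peak Q)")
      case True
      then have "choice P Q = peak Q" using PI QI by (simp add: gate_choice_def)
      then show ?thesis using peak_top[OF Q] by simp
    next
      case False
      then have *: "choice P Q = peak P" "r (peak Q) \<le> r (peak P)"
        using PI QI by (simp_all add: gate_choice_def)
      show ?thesis
      proof (cases "choice P Q' \<in> I")
        case True
        then have "r (peak P) \<le> r (choice P Q')"
          using PI l_last[OF PI] w_notin by (auto simp: gate_choice_def split: if_splits)
        then show ?thesis using * inside[OF Q QI PI True] by simp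
      next
        case False
        then show ?thesis using * leaving[OF Q QI PI] by simp
      qed
    qed
  next
    case QI: False
    then have *: "choice P Q = (if (w, l) \<in> Q then w else l)"
      using PI by (simp add: gate_choice_def)
    then have l: "(choice P Q, l) \<in> Q" and w: "(choice P Q, w) \<in> Q"
      using refl[OF Q] total[OF Q] by auto
    show ?thesis
    proof (cases "peak Q' \<in> I")
      case True
      then have "choice P Q' \<in> I" using PI by (simp add: gate_choice_def)
      then show ?thesis using trans[OF Q l] entering[OF Q QI] by blast
    next
      case False
      then have "choice P Q' \<in> {w, l}" using PI by (simp add: gate_choice_def)
      then show ?thesis using l w by auto
    qed
  qed
qed

lemma choice_tops_only: "tops_only D 2 (\<lambda>P. choice (P 1) (P 2))"
proof -
  have "is_rule D 2 (\<lambda>P. choice (P 1) (P 2))"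
    unfolding is_rule_def by (auto simp: gate_choice_def)
  moreover have "strategy_proof D 2 (\<lambda>P. choice (P 1) (P 2))"
    unfolding strategy_proof_def
  proof (intro ballI disjI2)
    fix P i Q assume P: "P \<in> profiles D 2" and i: "i \<in> {1..2::nat}" and Q: "Q \<in> D"
    have "P 1 \<in> D" "P 2 \<in> D" using P by (auto simp: profiles_def)
    moreover have "i = 1 \<or> i = 2" using i by auto
    ultimately show "(choice (P 1) (P 2), choice ((P(i := Q)) 1) ((P(i := Q)) 2)) \<in> P i"
      using choice_sp_1 choice_sp_2 Q by fastforce
  qed
  ultimately show ?thesis using tops_only_domain unfolding tops_only_domain_def by blast
qed

text \<open>With the first voter at \<open>l\<close>, the outcome reveals how the second ranks
  \<open>w\<close> and \<open>l\<close>, yet it depends only on that voter's peak.\<close>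

lemma comparison_tops_only:
  assumes "P \<in> D" "Q \<in> D" "peak P = peak Q" "peak P \<notin> I"
  shows "(w, l) \<in> P \<longleftrightarrow> (w, l) \<in> Q"
proof -
  obtain R where R: "R \<in> D" "peak R = l" using peak_surj by blast
  define prof where "prof B = (\<lambda>i\<in>{1..2::nat}. if i = 1 then R else B)" for B
  have "prof B \<in> profiles D 2" if "B \<in> D" for B
    using that R(1) by (auto simp: prof_def profiles_def)
  moreover have "\<forall>i\<in>{1..2}. peak (prof P i) = peak (prof Q i)"
    using assms(3) by (simp add: prof_def)
  ultimately have "choice (prof P 1) (prof P 2) = choice (prof Q 1) (prof Q 2)"
    using choice_tops_only assms(1,2) unfolding tops_only_def by blast
  then have "choice R P = choice R Q" by (simp add: prof_def)
  then show ?thesis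
    using assms(3,4) R(2) l_in w_notin by (auto simp: gate_choice_def split: if_splits)
qed

text \<open>The claim is clear at peak \<open>w\<close> and spreads along the graph: the two
  preferences of an edge outside \<open>I\<close> agree on \<open>w\<close> and \<open>l\<close>,
  and \<open>comparison_tops_only\<close> passes from one preference to all with the same
  peak.\<close>

lemma gate_order:
  assumes "P \<in> D" "peak P \<notin> I"
  shows "(w, l) \<in> P"
proof -
  have "y \<notin> I \<longrightarrow> (\<forall>P\<in>D. peak P = y \<longrightarrow> (w, l) \<in> P)" for y
    using reachable[of w y]
  proof (induction rule: rtranclp_induct)
    case base
    show ?case using peak_top by blast
  next
    case (step y z)
    obtain P Q where PQ: "P \<in> D" "Q \<in> D" "peak P = y" "peak Q = z"
      "\<And>x. x \<noteq> y \<Longrightarrow> (z, x) \<in> P"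
      "\<And>x x'. {x, x'} \<noteq> {y, z} \<Longrightarrow> (x, x') \<in> P \<longleftrightarrow> (x, x') \<in> Q"
      using adjacentE[OF step(2)] by metis
    show ?case
    proof (intro impI)
      assume z: "z \<notin> I"
      show "\<forall>P\<in>D. peak P = z \<longrightarrow> (w, l) \<in> P"
      proof (cases "y \<in> I")
        case True
        \<comment> \<open>An edge that leaves \<open>I\<close> leads to \<open>w\<close>: its end
          \<open>z\<close> comes second in \<open>P\<close>, and \<open>w\<close> is the best
          outsider.\<close>
        then have "(z, w) \<in> P" using PQ(5)[of w] w_notin by metis
        moreover have "(w, z) \<in> P" using leaving_w[OF PQ(1)] PQ(3) True z by blast
        ultimately have "z = w" using antisym[OF PQ(1)] by blast
        then show ?thesis using peak_top by blast
      next
        case False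
        then have "(w, l) \<in> P" using step.IH PQ(1,3) by blast
        moreover have "{w, l} \<noteq> {y, z}" using l_in z False by (auto simp: doubleton_eq_iff)
        ultimately have "(w, l) \<in> Q" using PQ(6) by blast
        then show ?thesis using comparison_tops_only PQ(2,4) z by metis
      qed
    qed
  qed
  then show ?thesis using assms by blast
qed

end

section \<open>Alternatives that separate the line\<close>

text \<open>The domain is single-peaked on the line if and only if all alternatives are good, and contained
  in a hybrid domain if and only if all alternatives outside the open interval between the two
  thresholds are.\<close>

definition good :: "'a::finite pref set \<Rightarrow> ('a \<Rightarrow> int) \<Rightarrow> 'a \<Rightarrow> bool" where
  "good D pos x \<longleftrightarrow> (\<forall>P\<in>D. \<forall>y.
     pos (peak P) \<le> pos x \<and> pos x \<le> pos y \<or> pos y \<le> pos x \<and> pos x \<le> pos (peak P) \<longrightarrow> (x, y) \<in> P)"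

lemma good_flip: "good D (\<lambda>x. - pos x) = good D pos"
  by (auto simp: good_def fun_eq_iff)

section \<open>Reversed preferences and the growth of a good initial segment\<close>

locale reversed_domain = connected_domain +
  fixes pos :: "'a \<Rightarrow> int" and Pl Pu :: "'a pref"
  assumes tops_only_domain: "tops_only_domain D"
    and Pl: "Pl \<in> D" and Pu: "Pu \<in> D"
    and Pl_iff: "(x, y) \<in> Pl \<longleftrightarrow> pos x \<le> pos y"
    and Pu_iff: "(x, y) \<in> Pu \<longleftrightarrow> pos y \<le> pos x"
begin

text \<open>Reflecting the line swaps \<open>Pl\<close> and \<open>Pu\<close>, so facts about the
  left end transfer to the right one. Integer positions make the reflection a mere negation.\<close>

lemma flip: "reversed_domain D (\<lambda>x. - pos x) Pu Pl"
  by unfold_locales (auto simp: tops_only_domain Pl Pu Pl_iff Pu_iff)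

lemma pos_inj: "pos x = pos y \<Longrightarrow> x = y"
  using antisym[OF Pl, of x y] by (simp add: Pl_iff)

lemma goodD1: "good D pos x \<Longrightarrow> P \<in> D \<Longrightarrow> pos (peak P) \<le> pos x \<Longrightarrow> pos x \<le> pos y \<Longrightarrow> (x, y) \<in> P"
  unfolding good_def by blast

lemma goodD2: "good D pos x \<Longrightarrow> P \<in> D \<Longrightarrow> pos y \<le> pos x \<Longrightarrow> pos x \<le> pos (peak P) \<Longrightarrow> (x, y) \<in> P"
  unfolding good_def by blast

lemma peak_Pl: "pos (peak Pl) \<le> pos x"
  using peak_top[OF Pl] by (simp add: Pl_iff)

lemma peak_Pu: "pos x \<le> pos (peak Pu)"
  using peak_top[OF Pu] by (simp add: Pu_iff)

text \<open>The initial segment up to \<open>l\<close> is a gate with exit \<open>w\<close>. For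
  peaks outside it \<open>gate_order\<close> puts \<open>w\<close> above \<open>l\<close>, and the
  good \<open>l\<close> is above the rest of the segment; peaks inside are covered by the assumption
  on \<open>w\<close>.\<close>

lemma extend_left:
  assumes low: "\<And>x. pos x \<le> pos l \<Longrightarrow> good D pos x"
    and lw: "pos l < pos w"
    and w_best: "\<And>P z. P \<in> D \<Longrightarrow> pos (peak P) \<le> pos l \<Longrightarrow> pos l < pos z \<Longrightarrow> (w, z) \<in> P"
    and x: "pos x \<le> pos w"
  shows "good D pos x"
proof -
  interpret gate D "{x. pos x \<le> pos l}" pos l w
  proof
    fix P y z
    assume "P \<in> D" "peak P \<in> {x. pos x \<le> pos l}" "y \<in> {x. pos x \<le> pos l}"
      "z \<in> {x. pos x \<le> pos l}" "pos (peak P) \<le> pos y" "pos y \<le> pos z"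
    then show "(y, z) \<in> P" using goodD1 low by blast
  next
    fix P z
    assume "P \<in> D" "peak P \<in> {x. pos x \<le> pos l}" "z \<notin> {x. pos x \<le> pos l}"
    then show "(l, z) \<in> P" "(w, z) \<in> P" using goodD1[OF low, of l P z] w_best[of P z] by auto
  next
    fix P y
    assume "P \<in> D" "peak P \<notin> {x. pos x \<le> pos l}" "y \<in> {x. pos x \<le> pos l}"
    then show "(l, y) \<in> P" using goodD2[OF low, of l P y] by auto
  qed (use lw tops_only_domain in auto)
  \<comment> \<open>Applied to \<open>Pl\<close>, the assumption makes \<open>w\<close> the
    immediate successor of \<open>l\<close> on the line.\<close>
  have w_next: "pos w \<le> pos z" if "pos l < pos z" for z
    using w_best[OF Pl peak_Pl that] by (simp add: Pl_iff)
  have "good D pos w"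
    unfolding good_def
  proof (intro ballI allI impI)
    fix P y assume P: "P \<in> D"
    assume "pos (peak P) \<le> pos w \<and> pos w \<le> pos y \<or> pos y \<le> pos w \<and> pos w \<le> pos (peak P)"
    then consider "pos (peak P) \<le> pos w" "pos w \<le> pos y" | "pos y \<le> pos w" "pos w \<le> pos (peak P)"
      by blast
    then show "(w, y) \<in> P"
    proof cases
      case 1
      show ?thesis
      proof (cases "pos (peak P) \<le> pos l")
        case True
        then show ?thesis using w_best[OF P] 1(2) lw by simp
      next
        case False
        then have "pos (peak P) = pos w" using w_next[of "peak P"] 1(1) by simp
        then have "peak P = w" by (rule pos_inj)
        then show ?thesis using peak_top[OF P] by metis
      qed
    next
      case 2
      show ?thesis
      proof (cases "pos y \<le> pos l")
        case True
        have "(w, l) \<in> P" using gate_order[OF P] 2 lw by simp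
        moreover have "(l, y) \<in> P" using goodD2[OF low P True] 2 lw by simp
        ultimately show ?thesis using trans[OF P] by blast
      next
        case False
        then have "pos y = pos w" using w_next[of y] 2(1) by simp
        then have "y = w" by (rule pos_inj)
        then show ?thesis using refl[OF P] by simp
      qed
    qed
  qed
  moreover have "x = w" if "\<not> pos x \<le> pos l"
    using pos_inj[of x w] w_next[of x] x that by linarith
  ultimately show ?thesis using low by blast
qed

text \<open>A preference witnessing the edge has peak \<open>x\<close> and ranks \<open>y\<close>
  second, yet the good \<open>al\<close> lies between \<open>x\<close> and \<open>y\<close> on the
  line.\<close>

lemma crossing:
  assumes "adjacent D x y" "good D pos al" "pos x < pos al" "pos al \<le> pos y"
  shows "y = al"
proof -
  obtain P where P: "P \<in> D" "peak P = x" "\<And>z. z \<noteq> x \<Longrightarrow> (y, z) \<in> P"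
    using adjacentE[OF assms(1)] by metis
  have "(al, y) \<in> P" using goodD1[OF assms(2) P(1)] P(2) assms(3,4) by simp
  moreover have "(y, al) \<in> P" by (rule P(3)) (use assms(3) in auto)
  ultimately show ?thesis using antisym[OF P(1)] by blast
qed

end

section \<open>The core between two good tails\<close>

text \<open>Invariant of the peeling: both tails, thresholds included, are good already. What
  remains open is the segment \<open>M\<close> between them, on which a rule may still be
  dictated.\<close>

locale core = reversed_domain +
  fixes al be :: 'a
  assumes al_be: "pos al < pos be"
    and low: "pos x \<le> pos al \<Longrightarrow> good D pos x"
    and high: "pos be \<le> pos x \<Longrightarrow> good D pos x"
begin

lemma core_flip: "core D (\<lambda>x. - pos x) Pu Pl be al"
proof -
  interpret f: reversed_domain D "\<lambda>x. - pos x" Pu Pl by (rule flip)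
  show ?thesis
    by unfold_locales (use al_be low high in \<open>auto simp: good_flip\<close>)
qed

definition M :: "'a set" where
  "M = {x. pos al \<le> pos x \<and> pos x \<le> pos be}"

text \<open>Retraction that collapses each tail to its threshold and turns walks in the whole graph
  into walks in \<open>M\<close>.\<close>

definition proj :: "'a \<Rightarrow> 'a" where
  "proj x = (if pos x < pos al then al else if pos be < pos x then be else x)"

lemma proj_M: "x \<in> M \<Longrightarrow> proj x = x"
  by (simp add: M_def proj_def)

lemma al_M: "al \<in> M" and be_M: "be \<in> M"
  using al_be by (auto simp: M_def)

lemma crossing_high:
  assumes "adjacent D x y" "pos be < pos x" "pos y \<le> pos be"
  shows "y = be"
  using reversed_domain.crossing[OF flip assms(1), of be] high[of be] assms(2,3)
  by (simp add: good_flip)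

lemma adjacent_proj:
  assumes "adjacent D x y"
  shows "proj x = proj y \<or> x \<in> M \<and> y \<in> M"
proof -
  note 1 = crossing[OF assms low[of al]] and 2 = crossing[OF adjacent_sym[OF assms] low[of al]]
    and 3 = crossing_high[OF assms] and 4 = crossing_high[OF adjacent_sym[OF assms]]
  show ?thesis
    using 1 2 3 4 al_be unfolding proj_def M_def
    by (cases "pos x < pos al"; cases "pos be < pos x"; cases "pos y < pos al"; cases "pos be < pos y")
      auto
qed

lemma M_connected:
  assumes "x \<in> M" "y \<in> M"
  shows "(adj_on M)\<^sup>*\<^sup>* x y"
proof -
  have "(adj_on M)\<^sup>*\<^sup>* (proj x) (proj z)" for z
    using reachable[of x z]
  proof (induction rule: rtranclp_induct)
    case (step y z)
    show ?case
    proof (cases "proj y = proj z")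
      case False
      then have "adj_on M (proj y) (proj z)"
        using adjacent_proj[OF step(2)] step(2) proj_M by (auto simp: adj_on_def)
      then show ?thesis using step.IH by simp
    qed (use step in simp)
  qed simp
  from this[of y] show ?thesis using proj_M assms by simp
qed

lemma M_edge: "\<exists>u v. adj_on M u v"
proof -
  have "(adj_on M)\<^sup>*\<^sup>* al be" using M_connected al_M be_M by blast
  moreover have "al \<noteq> be" using al_be by auto
  ultimately show ?thesis by (metis converse_rtranclpE)
qed

text \<open>Walking among the peaks that project to \<open>l\<close>, the outcome can change only if
  it equals the current peak. It never does, since it lies in \<open>M\<close> and differs from
  \<open>l\<close>.\<close>

lemma tail_value:
  assumes g: "pair_sp D g" and l: "l \<in> M" and r: "g l z \<in> M" "g l z \<noteq> l"
    and t: "proj t = l"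
  shows "g t z = g l z"
proof -
  have "proj t = l \<longrightarrow> g t z = g l z"
    using reachable[of l t]
  proof (induction rule: rtranclp_induct)
    case (step x y)
    show ?case
    proof
      assume y: "proj y = l"
      show "g y z = g l z"
      proof (cases "proj x = l")
        case True
        then have "g x z = g l z" using step.IH by simp
        then show ?thesis using pair_sp_edge[OF g step(2), of z] r proj_M True by metis
      next
        case False
        \<comment> \<open>A walk that comes back from elsewhere re-enters at \<open>l\<close>
          itself.\<close>
        then have "y \<in> M" using adjacent_proj[OF step(2)] y by simp
        then show ?thesis using y proj_M by simp
      qed
    qed
  qed simp
  then show ?thesis using t by simp
qed

text \<open>Against any \<open>z\<close> in \<open>M\<close> other than \<open>l\<close>, a voter
  whose peak projects to \<open>l\<close> obtains what the report \<open>w\<close> would yield. Two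
  possible deviations to the best such \<open>z\<close> then show \<open>z = w\<close>.\<close>

lemma leaf_best:
  assumes g: "pair_sp D g" and rule: "edge_rule (adj_on M) M g"
    and o: "oriented (adj_on M) g l w" and leaf: "\<And>y. adj_on M l y \<Longrightarrow> y = w"
    and P: "P \<in> D" "proj (peak P) = l" and y: "proj y \<noteq> l"
  shows "(w, y) \<in> P"
proof -
  interpret edge_rule "adj_on M" M g by (rule rule)
  note g' = pair_sp_flip[OF g]
  have o': "oriented (adj_on M) (\<lambda>x y. g y x) l w" using o oriented_flip by simp
  have lw: "adj_on M l w" "g l w = w" using o by (simp_all add: oriented_def)
  have M: "l \<in> M" "w \<in> M" using lw(1) by (simp_all add: adj_on_def)
  have lw': "l \<noteq> w" using lw(1) adjacent_irrefl by (auto simp: adj_on_def)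
  have val: "g (peak P) z = g w z" "g z (peak P) = g z w" "g w z \<noteq> l" "g w z \<in> M" "g z w \<noteq> l" "g z w \<in> M"
    if z: "z \<in> M" "z \<noteq> l" for z
  proof -
    have a: "g l z \<noteq> l" "g l z = g w z" using leaf_value[OF o leaf z] by auto
    have b: "g z l \<noteq> l" "g z l = g z w" using edge_rule.leaf_value[OF flip o' leaf z] by auto
    show "g w z \<noteq> l" "g z w \<noteq> l" "g w z \<in> M" "g z w \<in> M"
      using a b range_M z(1) M by auto
    then show "g (peak P) z = g w z" "g z (peak P) = g z w"
      using tail_value[OF g M(1) _ _ P(2), of z] tail_value[OF g' M(1) _ _ P(2), of z] a b by auto
  qed
  obtain z where z: "z \<in> M - {l}" "\<And>y. y \<in> M - {l} \<Longrightarrow> (z, y) \<in> P"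
    using best_exists[OF linear[OF P(1)], of "M - {l}"] M lw' by blast
  have zM: "z \<in> M" "z \<noteq> l" using z(1) by auto
  have sp: "(g (peak P) b, g a b) \<in> P" "(g b (peak P), g b a) \<in> P" for a b
    using g P(1) unfolding pair_sp_def by auto
  \<comment> \<open>Against \<open>z\<close>, a truthful second voter gets \<open>g z w\<close> but
    could secure \<open>z\<close>, so \<open>g z w = z\<close>. Against \<open>w\<close>, a truthful
    first voter gets \<open>w\<close> but could secure \<open>g z w\<close>.\<close>
  have "(g z w, z) \<in> P" using sp(2)[of z z] val(2)[OF zM] idem[OF zM(1)] by simp
  then have gzw: "g z w = z" using antisym[OF P(1)] z(2)[of "g z w"] val(5,6)[OF zM] by simp
  have "(w, z) \<in> P" using sp(1)[of w z] val(1)[OF M(2)] idem[OF M(2)] lw' gzw by simp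
  then have "w = z" using antisym[OF P(1)] z(2)[of w] M(2) lw' by simp
  with z(2) have w_best: "(w, y) \<in> P" if "y \<in> M" "y \<noteq> l" for y using that by simp
  show ?thesis
  proof (cases "y \<in> M")
    case True
    then show ?thesis using w_best y proj_M by simp
  next
    case False
    \<comment> \<open>The threshold next to \<open>y\<close> differs from \<open>l\<close>, hence is
      not above \<open>w\<close>; being good, it is ranked above the tail behind it.\<close>
    then consider "pos y < pos al" | "pos be < pos y" by (auto simp: M_def)
    then show ?thesis
    proof cases
      case 1
      then have "l \<noteq> al" using y by (auto simp: proj_def)
      then have "\<not> pos (peak P) < pos al" using P(2) by (auto simp: proj_def)
      then have "(al, y) \<in> P" using goodD2[OF low P(1)] 1 by simp
      then show ?thesis using trans[OF P(1) w_best[OF al_M]] \<open>l \<noteq> al\<close> by blast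
    next
      case 2
      then have "l \<noteq> be" using y al_be by (auto simp: proj_def)
      then have "\<not> pos be < pos (peak P)" using P(2) al_be by (auto simp: proj_def)
      then have "(be, y) \<in> P" using goodD1[OF high P(1)] 2 by simp
      then show ?thesis using trans[OF P(1) w_best[OF be_M]] \<open>l \<noteq> be\<close> by blast
    qed
  qed
qed

lemma shrink_at_al:
  assumes "w \<in> M" "w \<noteq> al"
    and best: "\<And>P y. P \<in> D \<Longrightarrow> proj (peak P) = al \<Longrightarrow> proj y \<noteq> al \<Longrightarrow> (w, y) \<in> P"
  shows "\<exists>w. pos al < pos w \<and> (\<forall>x. pos x \<le> pos w \<longrightarrow> good D pos x)"
proof -
  have "pos w \<noteq> pos al" using assms(2) pos_inj[of w al] by auto
  then have w: "pos al < pos w" using assms(1) by (auto simp: M_def)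
  have proj_al: "proj x = al \<longleftrightarrow> pos x \<le> pos al" for x
    using al_be pos_inj[of x al] by (auto simp: proj_def)
  have "good D pos x" if "pos x \<le> pos w" for x
    by (rule extend_left[OF low w _ that]) (use best proj_al in auto)
  with w show ?thesis by blast
qed

text \<open>Pruning produces a leaf of the core. If it is a threshold, \<open>extend_left\<close>
  moves the threshold inwards, at \<open>be\<close> after reflection; an inner leaf is
  impossible.\<close>

lemma shrink:
  assumes g: "pair_sp D g" and rule: "edge_rule (adj_on M) M g"
    and "oriented (adj_on M) g u v"
  shows "(\<exists>w. pos al < pos w \<and> (\<forall>x. pos x \<le> pos w \<longrightarrow> good D pos x)) \<or>
         (\<exists>w. pos w < pos be \<and> (\<forall>x. pos w \<le> pos x \<longrightarrow> good D pos x))"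
proof -
  obtain l w where o: "oriented (adj_on M) g l w" and leaf: "\<And>y. adj_on M l y \<Longrightarrow> y = w"
    using edge_rule.oriented_leaf[OF rule assms(3)] by blast
  note best = leaf_best[OF g rule o leaf]
  have M: "l \<in> M" "w \<in> M" "l \<noteq> w"
    using o adjacent_irrefl by (auto simp: oriented_def adj_on_def)
  consider "l = al" | "l = be" | "l \<noteq> al" "l \<noteq> be" by blast
  then show ?thesis
  proof cases
    case 1
    then show ?thesis using shrink_at_al[of w] best M by blast
  next
    case 2
    interpret f: core D "\<lambda>x. - pos x" Pu Pl be al by (rule core_flip)
    have "f.M = M" "f.proj = proj"
      using al_be by (auto simp: M_def f.M_def proj_def f.proj_def fun_eq_iff)
    then have "\<exists>w. - pos be < - pos w \<and> (\<forall>x. - pos x \<le> - pos w \<longrightarrow> good D (\<lambda>x. - pos x) x)"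
      using f.shrink_at_al[of w] best M 2 by metis
    then show ?thesis by (simp add: good_flip)
  next
    \<comment> \<open>The gate \<open>{l}\<close> would put \<open>w\<close> above \<open>l\<close>
      in both reversed preferences, as neither has the inner alternative \<open>l\<close> as its
      peak.\<close>
    case 3
    have "pos l \<noteq> pos al" "pos l \<noteq> pos be" using 3 pos_inj by blast+
    then have l: "pos al < pos l" "pos l < pos be" using M(1) by (auto simp: M_def)
    have proj_l: "proj x = l \<longleftrightarrow> x = l" for x
      using 3 l by (auto simp: proj_def)
    interpret gate D "{l}" pos l w
      by unfold_locales (use best M proj_l peak_top tops_only_domain refl in auto)
    have "peak Pl \<noteq> l" "peak Pu \<noteq> l" using peak_Pl[of al] peak_Pu[of be] l by auto
    then have "(w, l) \<in> Pl" "(w, l) \<in> Pu" using gate_order Pl Pu by auto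
    then have "pos w = pos l" by (simp add: Pl_iff Pu_iff)
    then show ?thesis using pos_inj M(3) by blast
  qed
qed

end

section \<open>Anonymous and non-dictatorial rules\<close>

context reversed_domain
begin

lemma good_Pl: "good D pos (peak Pl)"
proof -
  have eq: "x = peak Pl" if "pos x \<le> pos (peak Pl)" for x
    using pos_inj peak_Pl[of x] that by (metis order_antisym)
  show ?thesis
    unfolding good_def
  proof (intro ballI allI impI)
    fix P y assume P: "P \<in> D"
    assume "pos (peak P) \<le> pos (peak Pl) \<and> pos (peak Pl) \<le> pos y \<or>
      pos y \<le> pos (peak Pl) \<and> pos (peak Pl) \<le> pos (peak P)"
    then consider "peak P = peak Pl" | "y = peak Pl" using eq by blast
    then show "(peak Pl, y) \<in> P"
      by cases (use peak_top[OF P] refl[OF P] in metis)+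
  qed
qed

lemma core_all: "core D pos Pl Pu (peak Pl) (peak Pu)"
proof
  obtain x y :: 'a where "x \<noteq> y" using other_exists by blast
  then have "pos x \<noteq> pos y" using pos_inj by blast
  then show "pos (peak Pl) < pos (peak Pu)"
    using peak_Pl[of x] peak_Pl[of y] peak_Pu[of x] peak_Pu[of y] by linarith
next
  fix x
  assume "pos x \<le> pos (peak Pl)"
  then have "x = peak Pl" using pos_inj peak_Pl[of x] by (metis order_antisym)
  then show "good D pos x" using good_Pl by simp
next
  fix x
  assume "pos (peak Pu) \<le> pos x"
  then have "x = peak Pu" using pos_inj peak_Pu[of x] by (metis order_antisym)
  then show "good D pos x"
    using reversed_domain.good_Pl[OF flip] by (simp add: good_flip)
qed

text \<open>Induction on the distance between the thresholds. A dictator on \<open>M\<close>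
  contradicts anonymity, so some edge is oriented and \<open>shrink\<close> moves a threshold, until
  the good tails cover the line.\<close>

lemma anonymous_all_good:
  assumes n: "2 \<le> n" and f: "is_rule D n f" "strategy_proof D n f" "anonymous D n f"
  shows "good D pos x"
proof -
  have tops: "tops_only D n f" using tops_only_domain n f unfolding tops_only_domain_def by blast
  obtain F where fF: "\<forall>P\<in>profiles D n. f P = F (\<lambda>i. peak (P i))"
    and F: "top_sp D {1..n} F"
    and unan: "\<forall>x c. (\<forall>i\<in>{1..n}. x i = c) \<longrightarrow> F x = c"
    and anon: "anonymous D n f \<longrightarrow> (\<forall>\<sigma> x. \<sigma> permutes {1..n} \<longrightarrow> F (x \<circ> \<sigma>) = F x)"
    using tops_function[OF f(1,2) tops] by blast
  have unanimous: "F x = c" if "\<And>i. i \<in> {1..n} \<Longrightarrow> x i = c" for x c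
    using unan that by blast
  have anonymous: "F (x \<circ> \<sigma>) = F x" if "\<sigma> permutes {1..n}" for \<sigma> x
    using anon f(3) that by blast
  have "\<forall>x. good D pos x" if "core D pos Pl Pu al be" for al be
    using that
  proof (induction "nat (pos be - pos al)" arbitrary: al be rule: less_induct)
    case less
    interpret core D pos Pl Pu al be by (rule less.prems)
    obtain u v where uv: "adj_on M u v" using M_edge by blast
    show ?case
    proof (rule oriented_or_dictator[OF F finite_atLeastAtMost unanimous M_connected uv])
      fix g x y
      assume "pair_sp D g" "edge_rule (adj_on M) M g" "oriented (adj_on M) g x y"
      then consider w where "pos al < pos w" "\<And>x. pos x \<le> pos w \<Longrightarrow> good D pos x"
        | w where "pos w < pos be" "\<And>x. pos w \<le> pos x \<Longrightarrow> good D pos x"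
        using shrink by blast
      then show ?thesis
      proof cases
        case (1 w)
        show ?thesis
        proof (cases "pos w < pos be")
          case True
          then have "core D pos Pl Pu w be" using 1 high by unfold_locales auto
          then show ?thesis using less.hyps[of be w] 1(1) True by simp
        next
          case False
          \<comment> \<open>The enlarged tail meets the opposite one.\<close>
          then have "good D pos x" for x using 1(2)[of x] high[of x] by linarith
          then show ?thesis by blast
        qed
      next
        case (2 w)
        show ?thesis
        proof (cases "pos al < pos w")
          case True
          then have "core D pos Pl Pu al w" using 2 low by unfold_locales auto
          then show ?thesis using less.hyps[of w al] 2(1) True by simp
        next
          case False
          then have "good D pos x" for x using 2(2)[of x] low[of x] by linarith
          then show ?thesis by blast
        qed
      qed
    next
      fix d
      assume d: "d \<in> {1..n}" and dict: "\<And>x y. x \<in> M \<Longrightarrow> y \<in> M \<Longrightarrow> F (\<lambda>i. if i = d then x else y) = x"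
      obtain d' where d': "d' \<in> {1..n}" "d' \<noteq> d"
      proof (cases "d = 1")
        case True
        then show ?thesis using that[of 2] n by simp
      next
        case False
        then show ?thesis using that[of 1] n by simp
      qed
      have "u = v"
        using no_anonymous_dictator[OF F finite_atLeastAtMost d d' dict anonymous] uv
        by (auto simp: adj_on_def)
      then show ?thesis using uv adjacent_irrefl by (simp add: adj_on_def)
    qed auto
  qed
  then show ?thesis using core_all by blast
qed

text \<open>Dictation on the whole line makes the rule a dictatorship, so the first peeling step is
  available. Later ones need not be: a rule can be dictated on a proper segment without being a
  dictatorship.\<close>

lemma non_dictatorial_shrink:
  assumes "non_dictatorial D"
  shows "(\<exists>w. pos (peak Pl) < pos w \<and> (\<forall>x. pos x \<le> pos w \<longrightarrow> good D pos x)) \<or>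
         (\<exists>w. pos w < pos (peak Pu) \<and> (\<forall>x. pos w \<le> pos x \<longrightarrow> good D pos x))"
proof -
  interpret core D pos Pl Pu "peak Pl" "peak Pu" by (rule core_all)
  have M: "x \<in> M" for x using peak_Pl[of x] peak_Pu[of x] by (simp add: M_def del: One_nat_def)
  obtain n f where n: "2 \<le> n" and f: "is_rule D n f" "strategy_proof D n f" "\<not> dictatorship D n f"
    using assms unfolding non_dictatorial_def by blast
  have tops: "tops_only D n f" using tops_only_domain n f unfolding tops_only_domain_def by blast
  obtain F where fF: "\<forall>P\<in>profiles D n. f P = F (\<lambda>i. peak (P i))"
    and F: "top_sp D {1..n} F"
    and unan: "\<forall>x c. (\<forall>i\<in>{1..n}. x i = c) \<longrightarrow> F x = c"
    and anon: "anonymous D n f \<longrightarrow> (\<forall>\<sigma> x. \<sigma> permutes {1..n} \<longrightarrow> F (x \<circ> \<sigma>) = F x)"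
    using tops_function[OF f(1,2) tops] by blast
  have unanimous: "F x = c" if "\<And>i. i \<in> {1..n} \<Longrightarrow> x i = c" for x c
    using unan that by blast
  obtain u v where uv: "adj_on M u v" using M_edge by blast
  show ?thesis
  proof (rule oriented_or_dictator[OF F finite_atLeastAtMost unanimous M_connected uv])
    fix d
    assume d: "d \<in> {1..n}" and dict: "\<And>x y. x \<in> M \<Longrightarrow> y \<in> M \<Longrightarrow> F (\<lambda>i. if i = d then x else y) = x"
    have "F x = x d" for x
      by (rule dictator[OF F finite_atLeastAtMost d dict[OF M M]])
    then have "dictatorship D n f" using d fF unfolding dictatorship_def by auto
    then show ?thesis using f(3) by blast
  qed (use shrink in auto)
qed

lemma all_good_anonymous:
  assumes good: "\<And>x. good D pos x"
  shows "\<exists>n\<ge>2. \<exists>f. is_rule D n f \<and> anonymous D n f \<and> strategy_proof D n f"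
proof -
  \<comment> \<open>Choosing the left one of two peaks is symmetric and, with single-peaked
    preferences, strategy-proof.\<close>
  define h where "h x y = (if pos x \<le> pos y then x else y)" for x y
  define f where "f P = h (peak (P 1)) (peak (P 2))" for P :: "nat \<Rightarrow> 'a pref"
  have comm: "h x y = h y x" for x y
    using pos_inj[of x y] by (auto simp: h_def)
  have h: "(h (peak P) y, h x y) \<in> P" if P: "P \<in> D" for P x y
  proof (cases "pos (peak P) \<le> pos y")
    case True
    then show ?thesis using peak_top[OF P] by (simp add: h_def)
  next
    case False
    \<comment> \<open>When the other peak is further left, a deviation can only push the outcome
      further left still.\<close>
    then have "h (peak P) y = y" "pos (h x y) \<le> pos y" by (auto simp: h_def)
    then show ?thesis using goodD2[OF good P, of "h x y" y] False by simp
  qed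
  have "is_rule D 2 f"
    unfolding is_rule_def f_def h_def by auto
  moreover have "anonymous D 2 f"
    unfolding anonymous_def
  proof (intro ballI allI impI)
    fix P :: "nat \<Rightarrow> 'a pref" and \<sigma> :: "nat \<Rightarrow> nat"
    assume \<sigma>: "\<sigma> permutes {1..2}"
    have "\<sigma> 1 \<in> {1..2}" "\<sigma> 2 \<in> {1..2}" using permutes_in_image[OF \<sigma>] by simp_all
    moreover have "\<sigma> 1 \<noteq> \<sigma> 2" using permutes_inj[OF \<sigma>] by (simp add: inj_eq)
    ultimately have "\<sigma> 1 = 1 \<and> \<sigma> 2 = 2 \<or> \<sigma> 1 = 2 \<and> \<sigma> 2 = 1" by auto
    then show "f P = f (P \<circ> \<sigma>)"
      unfolding f_def using comm by auto
  qed
  moreover have "strategy_proof D 2 f"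
    unfolding strategy_proof_def
  proof (intro ballI disjI2)
    fix P i Q assume P: "P \<in> profiles D 2" and i: "i \<in> {1..2::nat}" and Q: "Q \<in> D"
    have P12: "P 1 \<in> D" "P 2 \<in> D" using P by (auto simp: profiles_def)
    have "i = 1 \<or> i = 2" using i by auto
    then show "(f P, f (P(i := Q))) \<in> P i"
    proof
      assume "i = 1"
      then show ?thesis using h[OF P12(1)] by (simp add: f_def)
    next
      assume "i = 2"
      then show ?thesis using h[OF P12(2), of "peak (P 1)" "peak Q"] by (simp add: f_def comm)
    qed
  qed
  ultimately show ?thesis by blast
qed

end

section \<open>Paths in trees\<close>

lemma path_between_rev:
  assumes "symp T" "path_between T x y p"
  shows "path_between T y x (rev p)"
proof -
  have "successively (\<lambda>u v. T v u) p"
    using assms by (auto simp: path_between_def elim!: successively_mono dest: sympD)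
  then show ?thesis
    using assms(2) unfolding path_between_def successively_rev by (simp add: hd_rev last_rev)
qed

locale tree_graph =
  fixes T :: "'a graph"
  assumes tree: "tree T"
begin

lemma symp_T: "symp T"
  using tree by (simp add: tree_def)

lemma path_exists: obtains p where "path_between T x y p"
  using tree unfolding tree_def by blast

lemma tree_path_eq: "path_between T x y p \<Longrightarrow> tree_path T x y = set p"
  using tree unfolding tree_path_def tree_def by (metis the1_equality)

lemma tree_path_sym: "tree_path T x y = tree_path T y x"
proof -
  obtain p where p: "path_between T x y p" by (rule path_exists)
  from tree_path_eq[OF this] tree_path_eq[OF path_between_rev[OF symp_T this]]
  show ?thesis by simp
qed

lemma tree_path_left: "x \<in> tree_path T x y"
proof -
  obtain p where p: "path_between T x y p" by (rule path_exists)
  then show ?thesis unfolding tree_path_eq[OF p] by (auto simp: path_between_def)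
qed

lemma tree_path_right: "y \<in> tree_path T x y"
  using tree_path_left tree_path_sym by metis

lemma tree_path_split:
  assumes "v \<in> tree_path T x y"
  shows "tree_path T x y = tree_path T x v \<union> tree_path T v y"
    and "tree_path T x v \<inter> tree_path T v y = {v}"
proof -
  obtain p where p: "path_between T x y p" by (rule path_exists)
  then have "v \<in> set p" using assms tree_path_eq by metis
  then obtain q r where pqr: "p = q @ v # r" by (meson split_list)
  have "path_between T x v (q @ [v])" "path_between T v y (v # r)"
    using p unfolding pqr path_between_def
    by (auto simp: successively_append_iff successively_Cons hd_append split: if_splits)
  then have 1: "tree_path T x v = insert v (set q)" "tree_path T v y = insert v (set r)"
    using tree_path_eq by fastforce+
  show "tree_path T x y = tree_path T x v \<union> tree_path T v y"
    using tree_path_eq[OF p] 1 pqr by auto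
  show "tree_path T x v \<inter> tree_path T v y = {v}"
    using p 1 unfolding pqr path_between_def by auto
qed

lemma tree_path_antisym:
  assumes "u \<in> tree_path T x v" "v \<in> tree_path T x u"
  shows "u = v"
  using tree_path_split[OF assms(2)] assms(1) tree_path_right[of u v] by blast

text \<open>The witness \<open>c\<close> is the first vertex of the path from \<open>z\<close> to \<open>y\<close> that lies on the path from
  \<open>x\<close> to \<open>y\<close>.\<close>

lemma tree_path_branch:
  obtains c where "c \<in> tree_path T x y" "c \<in> tree_path T z y" "c \<in> tree_path T x z"
    "tree_path T x z \<subseteq> tree_path T x y \<union> tree_path T z y"
proof -
  obtain p where p: "path_between T x y p" by (rule path_exists)
  obtain q where q: "path_between T z y q" by (rule path_exists)
  have "\<exists>v\<in>set q. v \<in> set p"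
    using p q unfolding path_between_def by (metis last_in_set)
  then obtain q1 c q2 where qs: "q = q1 @ c # q2" "c \<in> set p" "\<forall>v\<in>set q1. v \<notin> set p"
    using split_list_first_prop[where P = "\<lambda>v. v \<in> set p"] by blast
  then obtain p1 p2 where ps: "p = p1 @ c # p2" by (meson split_list)
  have "path_between T z c (q1 @ [c])"
    using q unfolding qs(1) path_between_def
    by (auto simp: successively_append_iff successively_Cons hd_append split: if_splits)
  then have "path_between T c z (c # rev q1)"
    using path_between_rev[OF symp_T, of z c "q1 @ [c]"] by simp
  then have "path_between T x z (p1 @ c # rev q1)"
    using p qs(3) unfolding ps path_between_def
    by (auto simp: successively_append_iff successively_Cons hd_append split: if_splits)
  then have "tree_path T x z = set p1 \<union> {c} \<union> set q1" using tree_path_eq by fastforce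
  then show thesis
    using that[of c] tree_path_eq[OF p] tree_path_eq[OF q] ps qs(1) by auto
qed

lemma tree_path_triangle: "tree_path T x z \<subseteq> tree_path T x y \<union> tree_path T y z"
  using tree_path_branch[of x y z] tree_path_sym by metis

text \<open>The projection is the branch vertex \<open>m\<close> of \<open>a\<close>,
  \<open>b\<close> and \<open>c\<close>. If it missed the path from \<open>c\<close> to
  \<open>u\<close>, it would lie on both parts into which \<open>u\<close> splits the path from
  \<open>a\<close> to \<open>b\<close>, so \<open>m = u\<close>.\<close>

lemma projection_unique:
  "\<exists>!v. v \<in> tree_path T a b \<and> (\<forall>u\<in>tree_path T a b. v \<in> tree_path T c u)"
proof -
  obtain m where m: "m \<in> tree_path T a b" "m \<in> tree_path T c b" "m \<in> tree_path T a c"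
    using tree_path_branch[of a b c] by metis
  have "m \<in> tree_path T c u" if u: "u \<in> tree_path T a b" for u
  proof (rule ccontr)
    assume no: "m \<notin> tree_path T c u"
    have "m \<in> tree_path T u b" using m(2) no tree_path_triangle[of c b u] by blast
    moreover have "m \<in> tree_path T a u"
      using m(3) no tree_path_triangle[of a c u] tree_path_sym[of u c] by blast
    ultimately have "m = u" using tree_path_split(2)[OF u] by blast
    then show False using no tree_path_right by blast
  qed
  then show ?thesis using m(1) tree_path_antisym by blast
qed

lemma threshold_sym:
  "dual_thresholds T a b \<longleftrightarrow> dual_thresholds T b a"
  unfolding dual_thresholds_def tree_path_sym[of b a] by (auto simp: insert_commute)

lemma threshold_cover:
  assumes "dual_thresholds T a b" "c \<notin> tree_path T a b"
  shows "c \<in> beyond T a b \<or> c \<in> beyond T b a"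
proof -
  let ?v = "projection T c (tree_path T a b)"
  have "?v \<in> tree_path T a b \<and> (\<forall>u\<in>tree_path T a b. ?v \<in> tree_path T c u)"
    unfolding projection_def by (rule theI'[OF projection_unique])
  then have v: "\<And>u. u \<in> tree_path T a b \<Longrightarrow> ?v \<in> tree_path T c u" by blast
  have "?v = a \<or> ?v = b" using assms unfolding dual_thresholds_def by blast
  then show ?thesis
    using v[OF tree_path_left] v[OF tree_path_right] by (auto simp: beyond_def)
qed

lemma beyond_self: "a \<in> beyond T a b"
  by (simp add: beyond_def tree_path_left)

lemma beyond_gate:
  assumes "t \<notin> beyond T a b" "z \<in> beyond T a b"
  shows "a \<in> tree_path T t z"
  using assms tree_path_triangle[of z b t] tree_path_sym[of z t] by (auto simp: beyond_def)

lemma beyond_disjoint: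
  assumes "a \<noteq> b" "z \<in> beyond T a b"
  shows "z \<notin> beyond T b a"
  using assms tree_path_antisym[of a z b] by (auto simp: beyond_def)

lemma beyond_convex:
  assumes "x \<in> beyond T a b" "c \<in> tree_path T x a"
  shows "c \<in> beyond T a b"
proof -
  have "a \<in> tree_path T x c \<or> a \<in> tree_path T c b"
    using assms(1) tree_path_triangle[of x b c] by (auto simp: beyond_def)
  then show ?thesis
    using tree_path_antisym[of a x c] assms(2) beyond_self by (auto simp: beyond_def)
qed

end

section \<open>Hybrid supersets on trees\<close>

text \<open>A competitor in the minimality condition for hybrid domains: its tree has no a priori
  relation to the line.\<close>

locale threshold_domain = reversed_domain D pos Pl Pu + tree_graph T
  for D :: "'a::finite pref set" and pos Pl Pu and T :: "'a graph" +
  fixes a b :: 'a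
  assumes thresholds: "dual_thresholds T a b"
    and hybrid: "D \<subseteq> hybrid_prefs T a b"
begin

lemma threshold_flip: "threshold_domain D (\<lambda>x. - pos x) Pu Pl T a b"
proof -
  interpret f: reversed_domain D "\<lambda>x. - pos x" Pu Pl by (rule flip)
  show ?thesis by unfold_locales (use thresholds hybrid in auto)
qed

lemma threshold_swap: "threshold_domain D pos Pl Pu T b a"
proof
  show "dual_thresholds T b a" using thresholds threshold_sym by blast
  show "D \<subseteq> hybrid_prefs T b a"
    using hybrid tree_path_sym[of a b] by (auto simp: hybrid_prefs_def simp del: One_nat_def)
qed

lemma ab: "a \<noteq> b"
  using thresholds by (simp add: dual_thresholds_def)

lemma hybrid_a:
  assumes "P \<in> D" "y \<in> beyond T a b" "z \<in> beyond T a b" "y \<in> tree_path T (peak P) z"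
  shows "(y, z) \<in> P"
proof (cases "y = z")
  case False
  then show ?thesis using assms hybrid unfolding hybrid_prefs_def by blast
qed (use refl assms in auto)

lemma hybrid_b:
  assumes "P \<in> D" "y \<in> beyond T b a" "z \<in> beyond T b a" "y \<in> tree_path T (peak P) z"
  shows "(y, z) \<in> P"
proof (cases "y = z")
  case False
  then show ?thesis using assms hybrid unfolding hybrid_prefs_def by blast
qed (use refl assms in auto)

lemma hybrid_best:
  assumes P: "P \<in> D" and "peak P \<in> beyond T a b" "peak P \<noteq> a" and z: "z \<in> tree_path T a b"
  shows "(a, z) \<in> P"
proof -
  have "best P (tree_path T a b) = a" using assms(1-3) hybrid unfolding hybrid_prefs_def by blast
  then show ?thesis using best_in[OF linear[OF P] z] by simp
qed

lemma cover: "x \<in> beyond T a b \<or> x \<in> tree_path T a b \<or> x \<in> beyond T b a"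
  using threshold_cover[OF thresholds] by blast

lemma gate_a: "t \<notin> beyond T a b - {a} \<Longrightarrow> z \<in> beyond T a b \<Longrightarrow> a \<in> tree_path T t z"
  using beyond_gate tree_path_left by blast

lemma gate_b: "t \<notin> beyond T b a \<Longrightarrow> z \<in> beyond T b a \<Longrightarrow> b \<in> tree_path T t z"
  using beyond_gate by blast

text \<open>The tail behind \<open>a\<close> is an initial segment of the line, and the tree path
  from \<open>peak Pl\<close> to \<open>a\<close> runs through it in the order of the line. Hybrid
  preferences are thus single-peaked along the line there.\<close>

lemma good_low:
  assumes o: "peak Pl \<in> beyond T a b" "peak Pl \<noteq> a"
  shows "x \<in> beyond T a b \<Longrightarrow> pos x \<le> pos a" "pos y \<le> pos a \<Longrightarrow> good D pos y"
proof -
  let ?X = "beyond T a b" and ?o = "peak Pl"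
  have ab_Pl: "(a, b) \<in> Pl" using hybrid_best[OF Pl o tree_path_right] .
  have Pu_notin: "peak Pu \<notin> ?X - {a}"
  proof
    assume "peak Pu \<in> ?X - {a}"
    then have "(a, b) \<in> Pu" using hybrid_best[OF Pu _ _ tree_path_right] by blast
    with ab_Pl have "pos a = pos b" by (simp add: Pl_iff Pu_iff)
    then show False using pos_inj ab by blast
  qed
  \<comment> \<open>Tree paths from \<open>peak Pu\<close> enter the tail through \<open>a\<close>,
    so \<open>Pu\<close> ranks \<open>a\<close> above the rest of it.\<close>
  have X_pos: "pos x \<le> pos a" if "x \<in> ?X" for x
    using hybrid_a[OF Pu beyond_self that gate_a[OF Pu_notin that]] by (simp add: Pu_iff)
  then show "x \<in> ?X \<Longrightarrow> pos x \<le> pos a" .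
  have M_pos: "pos a \<le> pos z" if "z \<in> tree_path T a b" for z
    using hybrid_best[OF Pl o that] by (simp add: Pl_iff)
  have B_pos: "pos a \<le> pos z" if "z \<in> beyond T b a" for z
  proof -
    have "b \<in> tree_path T ?o z" by (rule gate_b[OF beyond_disjoint[OF ab o(1)] that])
    then have "(b, z) \<in> Pl" using hybrid_b[OF Pl beyond_self that] by blast
    then show ?thesis using ab_Pl by (simp add: Pl_iff)
  qed
  have X_iff: "x \<in> ?X \<longleftrightarrow> pos x \<le> pos a" for x
  proof
    assume "pos x \<le> pos a"
    show "x \<in> ?X"
    proof (rule ccontr)
      assume "x \<notin> ?X"
      then have "pos a \<le> pos x" using cover M_pos B_pos by blast
      with \<open>pos x \<le> pos a\<close> have "x = a" using pos_inj by force
      then show False using beyond_self \<open>x \<notin> ?X\<close> by simp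
    qed
  qed (rule X_pos)
  \<comment> \<open>The vertex \<open>c\<close> where \<open>y\<close> branches off lies on the tree
    paths to \<open>y\<close> from both extreme peaks. Two reversed preferences can both rank
    \<open>c\<close> at least as high as \<open>y\<close> only if \<open>c = y\<close>.\<close>
  have on_path: "y \<in> tree_path T ?o a" if y: "y \<in> ?X" for y
  proof -
    obtain c where c: "c \<in> tree_path T ?o a" "c \<in> tree_path T y a" "c \<in> tree_path T ?o y"
      using tree_path_branch[of ?o a y] by metis
    have cX: "c \<in> ?X" by (rule beyond_convex[OF o(1) c(1)])
    have "(c, y) \<in> Pl" by (rule hybrid_a[OF Pl cX y c(3)])
    moreover have "c \<in> tree_path T (peak Pu) y"
      using tree_path_split(1)[OF gate_a[OF Pu_notin y]] c(2) tree_path_sym[of y a] by blast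
    then have "(c, y) \<in> Pu" by (rule hybrid_a[OF Pu cX y])
    ultimately have "pos c = pos y" by (simp add: Pl_iff Pu_iff)
    then have "c = y" by (rule pos_inj)
    then show ?thesis using c(1) by simp
  qed
  have ordered: "y \<in> tree_path T ?o z \<and> z \<in> tree_path T y a"
    if y: "y \<in> ?X" and z: "z \<in> ?X" and yz: "pos y \<le> pos z" for y z
  proof -
    have split: "y \<in> tree_path T ?o z \<or> y \<in> tree_path T z a" "z \<in> tree_path T ?o y \<or> z \<in> tree_path T y a"
      using tree_path_split(1)[OF on_path[OF z]] tree_path_split(1)[OF on_path[OF y]]
        on_path[OF y] on_path[OF z] by blast+
    have "z = y" if "z \<in> tree_path T ?o y"
    proof (rule pos_inj)
      show "pos z = pos y" using hybrid_a[OF Pl z y that] yz by (simp add: Pl_iff)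
    qed
    moreover have "y = z" if "y \<in> tree_path T z a" "z \<in> tree_path T y a"
      using tree_path_antisym[of y a z] that tree_path_sym by metis
    ultimately show ?thesis using split tree_path_left tree_path_right by metis
  qed
  have between: "v \<in> tree_path T u z"
    if "u \<in> ?X" "v \<in> ?X" "z \<in> ?X" "pos u \<le> pos v" "pos v \<le> pos z" for u v z
  proof -
    have u: "u \<in> tree_path T ?o v" and v: "v \<in> tree_path T ?o z" using ordered that by blast+
    have "v \<in> tree_path T ?o u \<or> v \<in> tree_path T u z" using v tree_path_triangle by blast
    then show ?thesis using tree_path_antisym[OF u] tree_path_left by blast
  qed
  show "good D pos y" if y: "pos y \<le> pos a" for y
    unfolding good_def
  proof (intro ballI allI impI)
    fix P z assume P: "P \<in> D"
    let ?t = "peak P"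
    assume "pos ?t \<le> pos y \<and> pos y \<le> pos z \<or> pos z \<le> pos y \<and> pos y \<le> pos ?t"
    then consider "pos ?t \<le> pos y" "pos y \<le> pos z" | "pos z \<le> pos y" "pos y \<le> pos ?t" by blast
    then show "(y, z) \<in> P"
    proof cases
      case 1
      have tX: "?t \<in> ?X" and yX: "y \<in> ?X" using X_iff y 1 by auto
      have inner: "(y, x) \<in> P" if "x \<in> ?X" "pos y \<le> pos x" for x
        by (rule hybrid_a[OF P yX that(1) between[OF tX yX that(1) 1(1) that(2)]])
      show ?thesis
      proof (cases "z \<in> ?X")
        case True
        then show ?thesis using inner 1(2) by blast
      next
        case zX: False
        show ?thesis
        proof (cases "?t = y")
          case True
          then show ?thesis using peak_top[OF P] by metis
        next
          case False
          then have "pos ?t \<noteq> pos y" using pos_inj by blast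
          then have ta: "?t \<noteq> a" using 1(1) y by auto
          have ya: "(y, a) \<in> P" using inner[OF beyond_self y] .
          have "(a, z) \<in> P"
          proof (cases "z \<in> tree_path T a b")
            case True
            then show ?thesis using hybrid_best[OF P tX ta] by blast
          next
            case False
            then have zb: "z \<in> beyond T b a" using cover zX by blast
            have "(a, b) \<in> P" using hybrid_best[OF P tX ta tree_path_right] .
            moreover have "(b, z) \<in> P"
              by (rule hybrid_b[OF P beyond_self zb gate_b[OF beyond_disjoint[OF ab tX] zb]])
            ultimately show ?thesis using trans[OF P] by blast
          qed
          then show ?thesis using trans[OF P ya] by blast
        qed
      qed
    next
      case 2
      have yX: "y \<in> ?X" and zX: "z \<in> ?X" using X_iff y 2 by auto
      have "y \<in> tree_path T ?t z"
      proof (cases "?t \<in> ?X")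
        case True
        then show ?thesis using between[OF zX yX True 2] tree_path_sym by blast
      next
        case False
        then have "a \<in> tree_path T ?t z" using gate_a zX by blast
        moreover have "y \<in> tree_path T a z" using ordered[OF zX yX 2(1)] tree_path_sym by blast
        ultimately show ?thesis using tree_path_split(1) by blast
      qed
      then show ?thesis using hybrid_a[OF P yX zX] by blast
    qed
  qed
qed

text \<open>If neither extreme peak lay in the tail apart from \<open>a\<close>, both reversed
  preferences would rank \<open>a\<close> above \<open>x\<close>. Hence \<open>good_low\<close>
  applies, directly or after reflection.\<close>

lemma good_tail:
  assumes x: "x \<in> beyond T a b" "x \<noteq> a"
  shows "pos x < pos a \<and> (\<forall>y. pos y \<le> pos a \<longrightarrow> good D pos y) \<or>
         pos a < pos x \<and> (\<forall>y. pos a \<le> pos y \<longrightarrow> good D pos y)"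
proof -
  have ne: "pos x \<noteq> pos a" using pos_inj x(2) by blast
  interpret f: threshold_domain D "\<lambda>x. - pos x" Pu Pl T a b by (rule threshold_flip)
  consider "peak Pl \<in> beyond T a b - {a}" | "peak Pu \<in> beyond T a b - {a}"
    | "peak Pl \<notin> beyond T a b - {a}" "peak Pu \<notin> beyond T a b - {a}" by blast
  then show ?thesis
  proof cases
    case 1
    then have "peak Pl \<in> beyond T a b" "peak Pl \<noteq> a" by auto
    from good_low[OF this] show ?thesis using x ne by fastforce
  next
    case 2
    then have "peak Pu \<in> beyond T a b" "peak Pu \<noteq> a" by auto
    from f.good_low[OF this] show ?thesis using x ne by (fastforce simp: good_flip)
  next
    case 3
    have "(a, x) \<in> Pl" "(a, x) \<in> Pu"
      using hybrid_a[OF Pl beyond_self x(1) gate_a[OF 3(1) x(1)]]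
        hybrid_a[OF Pu beyond_self x(1) gate_a[OF 3(2) x(1)]] by auto
    then show ?thesis using ne by (simp add: Pl_iff Pu_iff)
  qed
qed

end

section \<open>The line\<close>

lemma upto_successive: "successively (\<lambda>k l. l = k + 1) [i..j]"
  by (auto simp: successively_conv_nth nth_upto)

text \<open>A first step down is impossible: the rest of the list, increasing by induction, would
  climb from below \<open>x\<close> to a last entry above \<open>x\<close> and meet \<open>x\<close>
  again.\<close>

lemma distinct_unit_steps:
  fixes p :: "int list"
  assumes "distinct p" "successively (\<lambda>k l. \<bar>k - l\<bar> = 1) p" "p \<noteq> []" "hd p \<le> last p"
  shows "p = [hd p..last p]"
  using assms
proof (induction p)
  case (Cons x p)
  show ?case
  proof (cases p)
    case Nil
    then show ?thesis by simp
  next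
    case (Cons y q)
    have steps: "distinct p" "successively (\<lambda>k l. \<bar>k - l\<bar> = 1) p" "\<bar>x - y\<bar> = 1" "x \<notin> set p" "x \<le> last p"
      using Cons.prems Cons by auto
    have "last p \<in> set p" using Cons by simp
    with steps(4,5) have "x < last p" by (metis order_le_less)
    then have y_le: "y \<le> last p" using steps(3) by linarith
    have hd_p: "p \<noteq> []" "hd p = y" using Cons by simp_all
    then have "p = [hd p..last p]" using Cons.IH[OF steps(1,2)] y_le by blast
    then have p: "p = [y..last p]" unfolding hd_p(2) .
    have "y = x + 1"
    proof (rule ccontr)
      assume "y \<noteq> x + 1"
      then have "x \<in> {y..last p}" using steps(3,5) by auto
      then have "x \<in> set p" using p by (metis set_upto)
      then show False using steps(4) by simp
    qed
    then have "[x..last p] = x # p" using p steps(5) upto_rec1[of x "last p"] by (simp only:)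
    then show ?thesis using hd_p(1) by simp
  qed
qed simp

locale line_graph =
  fixes pos :: "'a::finite \<Rightarrow> int" and m :: int and T :: "'a graph"
  assumes inj: "inj pos" and range: "range pos = {1..m}"
    and T_iff: "T x y \<longleftrightarrow> \<bar>pos x - pos y\<bar> = 1"
begin

lemma T_symp: "symp T"
  by (auto simp: symp_def T_iff abs_minus_commute)

lemma path_positions:
  assumes p: "path_between T x y p" and "pos x \<le> pos y"
  shows "map pos p = [pos x..pos y]"
proof -
  have "distinct (map pos p)" "successively (\<lambda>k l. \<bar>k - l\<bar> = 1) (map pos p)" "map pos p \<noteq> []"
    using p inj by (auto simp: path_between_def distinct_map successively_map T_iff
        intro!: inj_on_subset[OF inj])
  moreover have "hd (map pos p) = pos x" "last (map pos p) = pos y"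
    using p by (auto simp: path_between_def hd_map last_map)
  ultimately show ?thesis using distinct_unit_steps[of "map pos p"] assms(2) by simp
qed

lemma path_line_exists:
  assumes "pos x \<le> pos y"
  shows "path_between T x y (map (inv pos) [pos x..pos y])"
proof -
  have in_range: "pos (inv pos k) = k" if "k \<in> {pos x..pos y}" for k
  proof -
    have "pos x \<in> {1..m}" "pos y \<in> {1..m}" using range by blast+
    then have "k \<in> range pos" using that range by auto
    then show ?thesis by (rule f_inv_into_f)
  qed
  have "successively (\<lambda>k l. T (inv pos k) (inv pos l)) [pos x..pos y]"
    by (rule successively_mono[OF upto_successive]) (simp add: T_iff in_range)
  moreover have "distinct (map (inv pos) [pos x..pos y])"
    unfolding distinct_map using in_range by (auto intro!: inj_onI) metis
  moreover have "hd [pos x..pos y] = pos x" "last [pos x..pos y] = pos y"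
    using assms by (simp_all add: hd_conv_nth last_conv_nth nth_upto)
  ultimately show ?thesis
    using assms inj by (simp add: path_between_def successively_map hd_map last_map)
qed

lemma tree_line: "tree T"
  unfolding tree_def
proof (intro conjI allI T_symp)
  show "irreflp T" by (auto simp: irreflp_def T_iff)
  have le: "\<exists>!p. path_between T x y p" if "pos x \<le> pos y" for x y
  proof (rule ex1I[where a = "map (inv pos) [pos x..pos y]"])
    show "path_between T x y (map (inv pos) [pos x..pos y])" by (rule path_line_exists[OF that])
    fix p assume "path_between T x y p"
    from path_positions[OF this that] path_positions[OF path_line_exists[OF that] that]
    show "p = map (inv pos) [pos x..pos y]" using inj by (metis inj_map_eq_map)
  qed
  show "\<exists>!p. path_between T x y p" for x y
  proof (cases "pos x \<le> pos y")
    case False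
    then have ex1: "\<exists>!p. path_between T y x p" using le by simp
    then obtain p where p: "path_between T y x p" by blast
    show ?thesis
    proof (rule ex1I[where a = "rev p"])
      show "path_between T x y (rev p)" by (rule path_between_rev[OF T_symp p])
      fix q assume "path_between T x y q"
      then have "rev q = p" using path_between_rev[OF T_symp] ex1 p by blast
      then show "q = rev p" by auto
    qed
  qed (use le in blast)
qed

sublocale tree_graph T
  by unfold_locales (rule tree_line)

lemma tree_path_line:
  "z \<in> tree_path T x y \<longleftrightarrow> pos x \<le> pos z \<and> pos z \<le> pos y \<or> pos y \<le> pos z \<and> pos z \<le> pos x"
proof -
  have le: "z \<in> tree_path T x y \<longleftrightarrow> pos x \<le> pos z \<and> pos z \<le> pos y" if "pos x \<le> pos y" for x y
  proof -
    obtain p where p: "path_between T x y p" by (rule path_exists)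
    have "pos ` set p = {pos x..pos y}"
      using path_positions[OF p that] by (metis list.set_map set_upto)
    then have "pos z \<in> {pos x..pos y} \<longleftrightarrow> z \<in> set p" using inj by (metis inj_image_mem_iff)
    then show ?thesis using tree_path_eq[OF p] by simp
  qed
  show ?thesis
  proof (cases "pos x \<le> pos y")
    case True
    show ?thesis using le[OF True] True by linarith
  next
    case False
    then have yx: "pos y \<le> pos x" by simp
    show ?thesis unfolding tree_path_sym[of x y] using le[OF yx] False by linarith
  qed
qed

lemma exists_at: "1 \<le> k \<Longrightarrow> k \<le> m \<Longrightarrow> \<exists>x. pos x = k"
  using range by (metis atLeastAtMost_iff imageE)

lemma pos_bounds: "1 \<le> pos x" "pos x \<le> m"
  using range by (metis atLeastAtMost_iff rangeI)+

lemma beyond_line: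
  assumes "pos al < pos be"
  shows "beyond T al be = {z. pos z \<le> pos al}" "beyond T be al = {z. pos be \<le> pos z}"
  using assms by (auto simp: beyond_def tree_path_line)

lemma thresholds_line:
  assumes "pos al < pos be"
  shows "dual_thresholds T al be"
  unfolding dual_thresholds_def
proof (intro conjI allI impI)
  show "al \<noteq> be" using assms by auto
  fix c assume c: "c \<notin> tree_path T al be"
  then consider "pos c < pos al" | "pos be < pos c" using assms by (auto simp: tree_path_line)
  then show "projection T c (tree_path T al be) \<in> {al, be}"
  proof cases
    case 1
    then have "projection T c (tree_path T al be) = al"
      unfolding projection_def using assms
      by (intro the1_equality[OF projection_unique]) (auto simp: tree_path_line)
    then show ?thesis by simp
  next
    case 2
    then have "projection T c (tree_path T al be) = be"
      unfolding projection_def using assms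
      by (intro the1_equality[OF projection_unique]) (auto simp: tree_path_line)
    then show ?thesis by simp
  qed
qed

end

section \<open>Single-peaked and hybrid domains on the line\<close>

locale line_domain = reversed_domain D pos Pl Pu + line_graph pos m T
  for D :: "'a::finite pref set" and pos Pl Pu and m and T :: "'a graph"
begin

lemma good_iff: "good D pos x \<longleftrightarrow> (\<forall>P\<in>D. \<forall>y. x \<in> tree_path T (peak P) y \<longrightarrow> (x, y) \<in> P)"
  by (simp only: good_def tree_path_line)

lemma single_peaked_iff: "single_peaked_domain D T \<longleftrightarrow> (\<forall>x. good D pos x)"
proof -
  have "D \<subseteq> SP_prefs T \<longleftrightarrow> (\<forall>x. good D pos x)"
  proof
    assume sub: "D \<subseteq> SP_prefs T"
    have "(x, y) \<in> P" if "P \<in> D" "x \<in> tree_path T (peak P) y" for P x y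
    proof (cases "x = y")
      case False
      then show ?thesis using sub that unfolding SP_prefs_def by blast
    qed (use refl that in auto)
    then show "\<forall>x. good D pos x" unfolding good_iff by blast
  next
    assume "\<forall>x. good D pos x"
    then show "D \<subseteq> SP_prefs T" unfolding good_iff SP_prefs_def using linear by blast
  qed
  then show ?thesis using tree_line connected by (simp add: single_peaked_domain_def)
qed

lemma hybrid_line:
  assumes ab: "pos al < pos be"
    and good: "\<And>x. pos x \<le> pos al \<or> pos be \<le> pos x \<Longrightarrow> good D pos x"
  shows "D \<subseteq> hybrid_prefs T al be"
proof
  fix P assume P: "P \<in> D"
  have "best P (tree_path T al be) = al" if "peak P \<in> beyond T al be - {al}"
  proof (rule best_eqI[OF linear[OF P] tree_path_left])
    fix y assume "y \<in> tree_path T al be"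
    then show "(al, y) \<in> P"
      using goodD1[OF good P, of al y] that ab by (auto simp: beyond_line tree_path_line)
  qed
  moreover have "best P (tree_path T al be) = be" if "peak P \<in> beyond T be al - {be}"
  proof (rule best_eqI[OF linear[OF P] tree_path_right])
    fix y assume "y \<in> tree_path T al be"
    then show "(be, y) \<in> P"
      using goodD2[OF good P, of be y] that ab by (auto simp: beyond_line tree_path_line)
  qed
  moreover have "(y, z) \<in> P"
    if "y \<in> beyond T al be \<or> y \<in> beyond T be al" "y \<in> tree_path T (peak P) z" for y z
    using good[of y] that P beyond_line[OF ab] good_iff by blast
  ultimately show "P \<in> hybrid_prefs T al be"
    unfolding hybrid_prefs_def using linear[OF P] by blast
qed

text \<open>If all alternatives were good, two neighbors on the path could serve as thresholds.
  Their path has only two vertices, against minimality and the bound of three.\<close>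

lemma hybrid_not_all_good:
  assumes hyb: "hybrid_domain D T x y"
  shows "\<exists>z. \<not> good D pos z"
proof (rule ccontr)
  assume "\<not> ?thesis"
  then have good: "good D pos z" for z by blast
  have False if sub: "tree_path T u v = tree_path T x y" and uv: "pos u < pos v" for u v
  proof -
    obtain w where w: "pos w = pos u + 1"
      using exists_at[of "pos u + 1"] pos_bounds[of u] pos_bounds[of v] uv by auto
    have path: "tree_path T u w = {u, w}"
    proof -
      have "z = u \<or> z = w" if "z \<in> tree_path T u w" for z
      proof -
        have "pos z = pos u \<or> pos z = pos w" using that w by (auto simp: tree_path_line)
        then show ?thesis using pos_inj by blast
      qed
      then show ?thesis using tree_path_left tree_path_right by blast
    qed
    have "tree_path T u w \<subseteq> tree_path T x y"
      using w uv unfolding sub[symmetric] by (auto simp: tree_path_line)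
    moreover have "card (tree_path T u w) \<le> 2" unfolding path by (simp add: card_insert_if)
    then have "tree_path T u w \<noteq> tree_path T x y"
      using hyb unfolding hybrid_domain_def by auto
    moreover have "D \<subseteq> hybrid_prefs T u w" "dual_thresholds T u w"
      using hybrid_line[of u w] thresholds_line[of u w] w good by auto
    ultimately show False
      using hyb tree_line unfolding hybrid_domain_def by blast
  qed
  moreover have "x \<noteq> y" using hyb by (auto simp: hybrid_domain_def dual_thresholds_def)
  then have "pos x < pos y \<or> pos y < pos x" using pos_inj by (metis linorder_neqE)
  ultimately show False using tree_path_sym by blast
qed

text \<open>The thresholds are placed directly outside the extreme alternatives that are not good,
  so that neither can be moved inwards.\<close>

lemma non_degenerate_hybrid_exists:
  assumes bad: "\<not> good D pos c"
    and shrink: "(\<exists>w. pos (peak Pl) < pos w \<and> (\<forall>x. pos x \<le> pos w \<longrightarrow> good D pos x)) \<or>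
         (\<exists>w. pos w < pos (peak Pu) \<and> (\<forall>x. pos w \<le> pos x \<longrightarrow> good D pos x))"
  shows "\<exists>x y. non_degenerate_hybrid_domain D T x y"
proof -
  define B where "B = {x. \<not> good D pos x}"
  have B: "finite (pos ` B)" "pos ` B \<noteq> {}" using bad by (auto simp: B_def)
  obtain b1 where b1: "b1 \<in> B" "pos b1 = Min (pos ` B)" using Min_in[OF B] by (metis imageE)
  obtain b2 where b2: "b2 \<in> B" "pos b2 = Max (pos ` B)" using Max_in[OF B] by (metis imageE)
  have b12: "pos b1 \<le> pos x" "pos x \<le> pos b2" if "x \<in> B" for x
    using that B(1) b1(2) b2(2) by auto
  have good_Pl': "good D pos (peak Pl)" and good_Pu': "good D pos (peak Pu)"
    using good_Pl reversed_domain.good_Pl[OF flip] by (auto simp: good_flip)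
  \<comment> \<open>The ends of the line are good, so \<open>b1\<close> and \<open>b2\<close> have
    outer neighbors to serve as thresholds.\<close>
  have "pos (peak Pl) \<noteq> pos b1" "pos (peak Pu) \<noteq> pos b2"
    using good_Pl' good_Pu' b1(1) b2(1) pos_inj unfolding B_def by blast+
  then have "pos (peak Pl) < pos b1" "pos b2 < pos (peak Pu)"
    using peak_Pl[of b1] peak_Pu[of b2] by auto
  then have "1 \<le> pos b1 - 1" "pos b1 - 1 \<le> m" "1 \<le> pos b2 + 1" "pos b2 + 1 \<le> m"
    using pos_bounds[of "peak Pl"] pos_bounds[of "peak Pu"] pos_bounds[of b1] pos_bounds[of b2]
    by linarith+
  then obtain al be where al: "pos al = pos b1 - 1" and be: "pos be = pos b2 + 1"
    using exists_at by metis
  have ab: "pos al < pos be" using al be b12(1)[OF b2(1)] by simp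
  have outside: "good D pos x" if "pos x \<le> pos al \<or> pos be \<le> pos x" for x
  proof (rule ccontr)
    assume "\<not> good D pos x"
    then have "pos b1 \<le> pos x" "pos x \<le> pos b2" using b12 unfolding B_def by blast+
    then show False using that al be by linarith
  qed
  have low_B: "pos u \<le> pos al" if "\<And>x. pos x \<le> pos u \<Longrightarrow> good D pos x" for u
  proof -
    have "\<not> pos b1 \<le> pos u" using that b1(1) unfolding B_def by blast
    then show ?thesis using al by linarith
  qed
  have high_B: "pos be \<le> pos u" if "\<And>x. pos u \<le> pos x \<Longrightarrow> good D pos x" for u
  proof -
    have "\<not> pos u \<le> pos b2" using that b2(1) unfolding B_def by blast
    then show ?thesis using be by linarith
  qed
  \<comment> \<open>A smaller path misses some \<open>x\<close> of the interval. This
    \<open>x\<close> lies in a tail of the competitor, so \<open>good_tail\<close> gives a good end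
    segment of the line reaching past \<open>x\<close>, against the choice of \<open>al\<close> and
    \<open>be\<close>.\<close>
  have minimal: False
    if T': "tree T'" "dual_thresholds T' a' b'" "D \<subseteq> hybrid_prefs T' a' b'"
      and less: "tree_path T' a' b' \<subset> tree_path T al be" for T' a' b'
  proof -
    interpret t: threshold_domain D pos Pl Pu T' a' b'
      by unfold_locales (use T' in auto)
    obtain x where x: "x \<in> tree_path T al be" "x \<notin> tree_path T' a' b'" using less by blast
    have pos_x: "pos al \<le> pos x" "pos x \<le> pos be" using x(1) ab by (auto simp: tree_path_line)
    have no: False
      if "pos x < pos u \<and> (\<forall>y. pos y \<le> pos u \<longrightarrow> good D pos y) \<or>
          pos u < pos x \<and> (\<forall>y. pos u \<le> pos y \<longrightarrow> good D pos y)" for u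
      using that
    proof
      assume "pos x < pos u \<and> (\<forall>y. pos y \<le> pos u \<longrightarrow> good D pos y)"
      then have "pos u \<le> pos al" "pos x < pos u" using low_B by blast+
      then show False using pos_x by linarith
    next
      assume "pos u < pos x \<and> (\<forall>y. pos u \<le> pos y \<longrightarrow> good D pos y)"
      then have "pos be \<le> pos u" "pos u < pos x" using high_B by blast+
      then show False using pos_x by linarith
    qed
    have "x \<noteq> a'" "x \<noteq> b'" using x(2) t.tree_path_left t.tree_path_right by blast+
    then show False
      using t.cover[of x] x(2) no t.good_tail threshold_domain.good_tail[OF t.threshold_swap] by blast
  qed
  have "card {al, b1, be} = 3" using al be b12(1)[OF b2(1)] by (auto simp: card_insert_if)
  moreover have "{al, b1, be} \<subseteq> tree_path T al be"
    using al be b12(1)[OF b2(1)] by (auto simp: tree_path_line)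
  ultimately have "3 \<le> card (tree_path T al be)" by (metis card_mono finite)
  then have "hybrid_domain D T al be"
    unfolding hybrid_domain_def
    using tree_line thresholds_line[OF ab] hybrid_line[OF ab outside] connected minimal by blast
  \<comment> \<open>A good end segment with more than one alternative fits into a tail, which is
    then more than its threshold.\<close>
  moreover have "beyond T al be \<noteq> {al} \<or> beyond T be al \<noteq> {be}"
    using shrink
  proof
    assume "\<exists>w. pos (peak Pl) < pos w \<and> (\<forall>x. pos x \<le> pos w \<longrightarrow> good D pos x)"
    then obtain w where "pos (peak Pl) < pos w" "pos w \<le> pos al" using low_B by blast
    then have "peak Pl \<in> beyond T al be" "peak Pl \<noteq> al" by (auto simp: beyond_line[OF ab])
    then show ?thesis by blast
  next
    assume "\<exists>w. pos w < pos (peak Pu) \<and> (\<forall>x. pos w \<le> pos x \<longrightarrow> good D pos x)"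
    then obtain w where "pos w < pos (peak Pu)" "pos be \<le> pos w" using high_B by blast
    then have "peak Pu \<in> beyond T be al" "peak Pu \<noteq> be" by (auto simp: beyond_line[OF ab])
    then show ?thesis by blast
  qed
  ultimately show ?thesis unfolding non_degenerate_hybrid_domain_def by blast
qed

end

theorem corollary2:
  fixes D :: "'a::finite pref set"
    and Pl Pu :: "'a pref"
    and a :: "nat \<Rightarrow> 'a"
  assumes "CARD('a) \<ge> 3"
    and "pref_domain D"
    and "non_dictatorial D"
    and "tops_only_domain D"
    and "unidimensional D"
    and "Pl \<in> D" and "Pu \<in> D" and "completely_reversed Pl Pu"
    and "labelling Pl Pu a"
  shows "((\<exists>n\<ge>2. \<exists>f. is_rule D n f \<and> anonymous D n f \<and> strategy_proof D n f) \<longleftrightarrow>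
            single_peaked_domain D (line a)) \<and>
         (\<not> (\<exists>n\<ge>2. \<exists>f. is_rule D n f \<and> anonymous D n f \<and> strategy_proof D n f) \<longleftrightarrow>
            (\<exists>x y. non_degenerate_hybrid_domain D (line a) x y))"
proof -
  define m where "m = CARD('a)"
  have linear: "linear_order P" if "P \<in> D" for P
    using assms(2) that by (simp add: pref_domain_def)
  have bij: "bij_betw a {1..m} UNIV"
    and consecutive: "\<And>k. k \<in> {1..<m} \<Longrightarrow> (a k, a (k + 1)) \<in> Pl \<and> (a (k + 1), a k) \<in> Pu"
    using assms(9) by (auto simp: labelling_def m_def)
  define idx where "idx = inv_into {1..m} a"
  have idx: "idx x \<in> {1..m}" "a (idx x) = x" for x
    using bij unfolding idx_def by (metis UNIV_I bij_betw_def inv_into_into f_inv_into_f)+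
  have idx_a: "idx (a k) = k" if "k \<in> {1..m}" for k
    using bij that unfolding idx_def by (meson bij_betw_def inv_into_f_f)
  have mono: "(a i, a j) \<in> Pl \<and> (a j, a i) \<in> Pu" if "1 \<le> i" "i \<le> j" "j \<le> m" for i j
    using that(2,3)
  proof (induction j rule: dec_induct)
    case base
    show ?case using lin_refl[OF linear[OF assms(6)]] lin_refl[OF linear[OF assms(7)]] by simp
  next
    case (step k)
    have "(a k, a (Suc k)) \<in> Pl" "(a (Suc k), a k) \<in> Pu"
      using consecutive[of k] step that(1) by auto
    moreover have "(a i, a k) \<in> Pl" "(a k, a i) \<in> Pu" using step by auto
    ultimately show ?case
      using lin_trans[OF linear[OF assms(6)]] lin_trans[OF linear[OF assms(7)]] by blast
  qed
  define pos where "pos x = int (idx x)" for x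
  have le: "(x, y) \<in> Pl \<and> (y, x) \<in> Pu" if "idx x \<le> idx y" for x y
    using mono[of "idx x" "idx y"] idx that by auto
  have idx_inj: "idx x = idx y \<Longrightarrow> x = y" for x y using idx(2) by metis
  interpret line_domain D pos Pl Pu "int m" "line a"
  proof
    show "graph_connected (adjacent D)" using assms(5) by (simp add: unidimensional_def)
    show "2 \<le> CARD('a)" using assms(1) by simp
    show "(x, y) \<in> Pl \<longleftrightarrow> pos x \<le> pos y" for x y
      using le[of x y] le[of y x] lin_antisym[OF linear[OF assms(6)], of x y] unfolding pos_def by fastforce
    show "(x, y) \<in> Pu \<longleftrightarrow> pos y \<le> pos x" for x y
      using le[of x y] le[of y x] lin_antisym[OF linear[OF assms(7)], of x y] unfolding pos_def by fastforce
    show "inj pos" using idx_inj by (auto simp: pos_def inj_def)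
    show "range pos = {1..int m}"
    proof
      show "range pos \<subseteq> {1..int m}" using idx(1) by (auto simp: pos_def)
      show "{1..int m} \<subseteq> range pos"
      proof
        fix k assume "k \<in> {1..int m}"
        then have "nat k \<in> {1..m}" "int (nat k) = k" by auto
        then have "pos (a (nat k)) = k" using idx_a by (simp add: pos_def)
        then show "k \<in> range pos" by (metis rangeI)
      qed
    qed
    show "line a x y \<longleftrightarrow> \<bar>pos x - pos y\<bar> = 1" for x y
    proof
      assume "line a x y"
      then obtain k where k: "k \<in> {1..<m}" "{x, y} = {a k, a (k + 1)}"
        unfolding line_def m_def by blast
      then show "\<bar>pos x - pos y\<bar> = 1"
        using idx_a[of k] idx_a[of "k + 1"] by (auto simp: doubleton_eq_iff pos_def)
    next
      assume "\<bar>pos x - pos y\<bar> = 1"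
      then consider "idx y = idx x + 1" | "idx x = idx y + 1" unfolding pos_def by linarith
      then show "line a x y"
      proof cases
        case 1
        then have "idx x \<in> {1..<m}" "{x, y} = {a (idx x), a (idx x + 1)}"
          using idx(1)[of x] idx(1)[of y] idx(2)[of x] idx(2)[of y] by auto
        then show ?thesis unfolding line_def m_def by blast
      next
        case 2
        then have "idx y \<in> {1..<m}" "{x, y} = {a (idx y), a (idx y + 1)}"
          using idx(1)[of x] idx(1)[of y] idx(2)[of x] idx(2)[of y] by auto
        then show ?thesis unfolding line_def m_def by blast
      qed
    qed
  qed (use linear assms(4,6,7) in auto)
  \<comment> \<open>All notions reduce to one condition, that every alternative is good: anonymous
    rules and single-peakedness amount to it, non-degenerate hybridness to its failure.\<close>
  have anonymous_iff: "(\<exists>n\<ge>2. \<exists>f. is_rule D n f \<and> anonymous D n f \<and> strategy_proof D n f) \<longleftrightarrow>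
      (\<forall>x. good D pos x)"
    using anonymous_all_good all_good_anonymous by blast
  have hybrid_iff: "(\<exists>x y. non_degenerate_hybrid_domain D (line a) x y) \<longleftrightarrow> \<not> (\<forall>x. good D pos x)"
    using hybrid_not_all_good non_degenerate_hybrid_exists[OF _ non_dictatorial_shrink[OF assms(3)]]
    unfolding non_degenerate_hybrid_domain_def by blast
  show ?thesis unfolding anonymous_iff hybrid_iff single_peaked_iff by blast
qed

end
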